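(* Let $(p_h^i,\phi_h)$ be the finite element solution on the fine grid, let $(p_H^i,\phi_H)$ be the finite element solution on the coarse grid, and let $(p_h^{i,*},\phi_h^* )$ be the semi-decoupled two-grid solution on the fine grid ($i=1,2$), all as defined in the context. Suppose that $\phi_h\in W^{1,\infty}(\Omega)$ and $p_H^i\in L^\infty(\Omega)$. Then $$\|\nabla(p_h^i-p_h^{i,*})\|_{0,\Omega}\le C\sum_{j=1}^2\|p_h^j-p_H^j\|_{0,\Omega},$$ where $C$ denotes a positive constant independent of $h$.
   Context: Let $\Omega\subset\mathbb{R}^d$ ($d=2,3$) be a bounded Lipschitz domain, $(\cdot,\cdot)$ the $L^2(\Omega)$ inner product, and $\|\cdot\|_{0,\Omega}$ the $L^2(\Omega)$ norm. Let $q^1=1$, $q^2=-1$, and let $F_1,F_2,F_3$ be the given reaction source terms. Let $\Gamma_h$ be a quasi-uniform triangulation of $\Omega$ with mesh size $h>0$, and let $S_h(\Omega)=\{v\in H^1(\Omega): v|_{\partial\Omega}=0 \text{ and } v|_e \text{ is a linear polynomial for every } e\in\Gamma_h\}$. The coarse space $S_H(\Omega)$ is defined by replacing $h$ with $H$. Standing assumption: the weak steady-state Poisson-Nernst-Planck problem, find $p^1,p^2,\phi\in H_0^1(\Omega)$ with $(\nabla p^i,\nabla v)+(q^ip^i\nabla\phi,\nabla v)=(F_i,v)$ for all $v\in H_0^1(\Omega)$, $i=1,2$, and $(\nabla\phi,\nabla w)=\sum_{i=1}^2 q^i(p^i,w)+(F_3,w)$ for all $w\in H_0^1(\Omega)$,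 has a unique solution, and so does its finite element approximation below. Finite element solution on the fine grid: $(p_h^1,p_h^2,\phi_h)\in[S_h(\Omega)]^3$ satisfies $$(\nabla p_h^i,\nabla v_h)+(q^ip_h^i\nabla\phi_h,\nabla v_h)=(F_i,v_h)\quad\forall v_h\in S_h(\Omega),\ i=1,2,$$ $$(\nabla\phi_h,\nabla w_h)=\sum_{i=1}^2q^i(p_h^i,w_h)+(F_3,w_h)\quad\forall w_h\in S_h(\Omega).$$ Finite element solution on the coarse grid: $(p_H^1,p_H^2,\phi_H)\in[S_H(\Omega)]^3$ satisfies the same system with $h$ replaced by $H$ throughout. Semi-decoupled two-grid solution: first $\phi_h^*\in S_h(\Omega)$ is determined by $$(\nabla\phi_h^*,\nabla w_h)=\sum_{i=1}^2q^i(p_H^i,w_h)+(F_3,w_h)\quad\forall w_h\in S_h(\Omega),$$ and then $(p_h^{1,*},p_h^{2,*})\in[S_h(\Omega)]^2$ by $$(\nabla p_h^{i,*},\nabla v_h)+(q^ip_H^i\nabla\phi_h^*,\nabla v_h)=(F_i,v_h)\quad\forall v_h\in S_h(\Omega),\ i=1,2.$$ *)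

theory Defs
  imports "HOL-Analysis.Analysis" "HOL-Probability.Essential_Supremum"
begin

section \<open>Domains\<close>

text \<open>Near every boundary point the set is the strict epigraph, in some direction \<open>\<nu>\<close>, of a
  Lipschitz function on the hyperplane orthogonal to \<open>\<nu>\<close>.\<close>

definition lipschitz_boundary :: "'a::euclidean_space set \<Rightarrow> bool" where
  "lipschitz_boundary \<Omega> \<longleftrightarrow>
     (\<forall>x\<in>frontier \<Omega>. \<exists>r>0. \<exists>\<nu> L \<gamma>. norm \<nu> = 1 \<and> lipschitz_on L {z. z \<bullet> \<nu> = 0} \<gamma> \<and>
        \<Omega> \<inter> ball x r = {y \<in> ball x r. \<gamma> (y - (y \<bullet> \<nu>) *\<^sub>R \<nu>) < y \<bullet> \<nu>})"

definition bounded_lipschitz_domain :: "'a::euclidean_space set \<Rightarrow> bool" where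
  "bounded_lipschitz_domain \<Omega> \<longleftrightarrow>
     open \<Omega> \<and> connected \<Omega> \<and> \<Omega> \<noteq> {} \<and> bounded \<Omega> \<and> lipschitz_boundary \<Omega>"


section \<open>Lebesgue and Sobolev spaces\<close>

text \<open>Functions on \<open>\<Omega>\<close> are total functions whose values outside \<open>\<Omega>\<close> are irrelevant (outside
  \<open>closure \<Omega>\<close> for finite element functions); elements of Lebesgue and Sobolev spaces are
  representatives, to be identified when they agree almost everywhere on \<open>\<Omega>\<close>.\<close>

definition l2_inner ::
    "'a::euclidean_space set \<Rightarrow> ('a \<Rightarrow> 'b::euclidean_space) \<Rightarrow> ('a \<Rightarrow> 'b) \<Rightarrow> real" where
  "l2_inner \<Omega> u v = integral\<^sup>L (lebesgue_on \<Omega>) (\<lambda>x. u x \<bullet> v x)"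

definition l2_norm :: "'a::euclidean_space set \<Rightarrow> ('a \<Rightarrow> 'b::euclidean_space) \<Rightarrow> real" where
  "l2_norm \<Omega> u = sqrt (l2_inner \<Omega> u u)"

definition L2 :: "'a::euclidean_space set \<Rightarrow> ('a \<Rightarrow> 'b::euclidean_space) set" where
  "L2 \<Omega> = {u \<in> borel_measurable (lebesgue_on \<Omega>).
             integrable (lebesgue_on \<Omega>) (\<lambda>x. (norm (u x))\<^sup>2)}"

definition linf_norm :: "'a::euclidean_space set \<Rightarrow> ('a \<Rightarrow> 'b::euclidean_space) \<Rightarrow> ereal" where
  "linf_norm \<Omega> u = esssup (lebesgue_on \<Omega>) (\<lambda>x. ereal (norm (u x)))"

definition Linf :: "'a::euclidean_space set \<Rightarrow> ('a \<Rightarrow> 'b::euclidean_space) set" where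
  "Linf \<Omega> = {u \<in> borel_measurable (lebesgue_on \<Omega>). linf_norm \<Omega> u < \<infinity>}"

primrec Ck :: "nat \<Rightarrow> ('a::euclidean_space \<Rightarrow> real) \<Rightarrow> bool" where
  "Ck 0 f \<longleftrightarrow> continuous_on UNIV f"
| "Ck (Suc k) f \<longleftrightarrow>
     (\<forall>x. f differentiable (at x)) \<and> (\<forall>v. Ck k (\<lambda>x. frechet_derivative f (at x) v))"

text \<open>The space \<open>C\<^sub>c\<^sup>\<infinity>(\<Omega>)\<close>, each function being extended by zero to the whole space.\<close>

definition test_functions :: "'a::euclidean_space set \<Rightarrow> ('a \<Rightarrow> real) set" where
  "test_functions \<Omega> =
     {\<psi>. (\<forall>k. Ck k \<psi>) \<and> (\<exists>K. compact K \<and> K \<subseteq> \<Omega> \<and> (\<forall>x. x \<notin> K \<longrightarrow> \<psi> x = 0))}"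

definition locally_integrable ::
    "'a::euclidean_space set \<Rightarrow> ('a \<Rightarrow> 'b::euclidean_space) \<Rightarrow> bool" where
  "locally_integrable \<Omega> u \<longleftrightarrow> (\<forall>K. compact K \<and> K \<subseteq> \<Omega> \<longrightarrow> u absolutely_integrable_on K)"

definition has_weak_gradient ::
    "'a::euclidean_space set \<Rightarrow> ('a \<Rightarrow> real) \<Rightarrow> ('a \<Rightarrow> 'a) \<Rightarrow> bool" where
  "has_weak_gradient \<Omega> u g \<longleftrightarrow>
     locally_integrable \<Omega> u \<and> locally_integrable \<Omega> g \<and>
     (\<forall>\<psi>\<in>test_functions \<Omega>. \<forall>b\<in>Basis.
        integral\<^sup>L (lebesgue_on \<Omega>) (\<lambda>x. u x * frechet_derivative \<psi> (at x) b) =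
        - integral\<^sup>L (lebesgue_on \<Omega>) (\<lambda>x. (g x \<bullet> b) * \<psi> x))"

text \<open>The weak gradient is determined only up to null sets; \<open>wgrad\<close> picks a representative
  and is arbitrary for functions without a weak gradient.\<close>

definition wgrad :: "'a::euclidean_space set \<Rightarrow> ('a \<Rightarrow> real) \<Rightarrow> 'a \<Rightarrow> 'a" where
  "wgrad \<Omega> u = (SOME g. has_weak_gradient \<Omega> u g)"

definition H1 :: "'a::euclidean_space set \<Rightarrow> ('a \<Rightarrow> real) set" where
  "H1 \<Omega> = {u \<in> L2 \<Omega>. (\<exists>g. has_weak_gradient \<Omega> u g) \<and> wgrad \<Omega> u \<in> L2 \<Omega>}"

definition h1_norm :: "'a::euclidean_space set \<Rightarrow> ('a \<Rightarrow> real) \<Rightarrow> real" where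
  "h1_norm \<Omega> u = sqrt ((l2_norm \<Omega> u)\<^sup>2 + (l2_norm \<Omega> (wgrad \<Omega> u))\<^sup>2)"

text \<open>\<open>H\<^sub>0\<^sup>1(\<Omega>)\<close> is the closure of the test functions in \<open>H\<^sup>1(\<Omega>)\<close>.\<close>

definition H10 :: "'a::euclidean_space set \<Rightarrow> ('a \<Rightarrow> real) set" where
  "H10 \<Omega> = {u \<in> H1 \<Omega>. \<forall>\<epsilon>>0. \<exists>\<psi>\<in>test_functions \<Omega>. h1_norm \<Omega> (\<lambda>x. u x - \<psi> x) < \<epsilon>}"

definition W1inf :: "'a::euclidean_space set \<Rightarrow> ('a \<Rightarrow> real) set" where
  "W1inf \<Omega> = {u \<in> Linf \<Omega>. (\<exists>g. has_weak_gradient \<Omega> u g) \<and> wgrad \<Omega> u \<in> Linf \<Omega>}"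

definition w1inf_norm :: "'a::euclidean_space set \<Rightarrow> ('a \<Rightarrow> real) \<Rightarrow> ereal" where
  "w1inf_norm \<Omega> u = max (linf_norm \<Omega> u) (linf_norm \<Omega> (wgrad \<Omega> u))"


section \<open>Quasi-uniform triangulations and linear finite elements\<close>

definition triangulation_of :: "'a::euclidean_space set \<Rightarrow> 'a set set \<Rightarrow> bool" where
  "triangulation_of \<Omega> \<T> \<longleftrightarrow>
     triangulation \<T> \<and> (\<forall>e\<in>\<T>. int DIM('a) simplex e) \<and> \<Union>\<T> = closure \<Omega>"

text \<open>\<open>I\<close> is the set of mesh sizes of the family. The mesh size of a triangulation is its largest
  element diameter, and quasi-uniformity asks every element to contain a ball of radius
  comparable to the mesh size, with one constant for the whole family.\<close>

definition quasi_uniform_family ::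
    "'a::euclidean_space set \<Rightarrow> real set \<Rightarrow> (real \<Rightarrow> 'a set set) \<Rightarrow> bool" where
  "quasi_uniform_family \<Omega> I \<Gamma> \<longleftrightarrow>
     (\<forall>h\<in>I. h > 0 \<and> triangulation_of \<Omega> (\<Gamma> h) \<and> h = Max (diameter ` \<Gamma> h)) \<and>
     (\<exists>\<sigma>>0. \<forall>h\<in>I. \<forall>e\<in>\<Gamma> h. \<exists>x. ball x (\<sigma> * h) \<subseteq> e)"

text \<open>The elements are closed simplices covering \<open>closure \<Omega>\<close>, so the functions below are the
  continuous representatives, for which vanishing on the boundary is meant pointwise.\<close>

definition Sh :: "'a::euclidean_space set \<Rightarrow> 'a set set \<Rightarrow> ('a \<Rightarrow> real) set" where
  "Sh \<Omega> \<T> = {v \<in> H1 \<Omega>. (\<forall>x\<in>frontier \<Omega>. v x = 0) \<and>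
                        (\<forall>e\<in>\<T>. \<exists>a b. \<forall>x\<in>e. v x = a + b \<bullet> x)}"


section \<open>The steady-state Poisson-Nernst-Planck system\<close>

definition q :: "nat \<Rightarrow> real" where
  "q i = (if i = 1 then 1 else - 1)"

text \<open>The variational system with trial and test space \<open>V\<close>. The concentrations are \<open>p 1\<close> and
  \<open>p 2\<close>, the sources \<open>F 1\<close>, \<open>F 2\<close> and \<open>F 3\<close>.\<close>

definition pnp_system ::
    "'a::euclidean_space set \<Rightarrow> ('a \<Rightarrow> real) set \<Rightarrow> (nat \<Rightarrow> 'a \<Rightarrow> real) \<Rightarrow>
     (nat \<Rightarrow> 'a \<Rightarrow> real) \<Rightarrow> ('a \<Rightarrow> real) \<Rightarrow> bool" where
  "pnp_system \<Omega> V F p \<phi> \<longleftrightarrow>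
     (\<forall>i\<in>{1,2}. p i \<in> V) \<and> \<phi> \<in> V \<and>
     (\<forall>i\<in>{1,2}. \<forall>v\<in>V.
        l2_inner \<Omega> (wgrad \<Omega> (p i)) (wgrad \<Omega> v)
        + l2_inner \<Omega> (\<lambda>x. (q i * p i x) *\<^sub>R wgrad \<Omega> \<phi> x) (wgrad \<Omega> v)
        = l2_inner \<Omega> (F i) v) \<and>
     (\<forall>w\<in>V. l2_inner \<Omega> (wgrad \<Omega> \<phi>) (wgrad \<Omega> w)
        = (\<Sum>i\<in>{1,2}. q i * l2_inner \<Omega> (p i) w) + l2_inner \<Omega> (F 3) w)"

text \<open>For general \<open>H\<^sup>1\<close> functions the drift integrand need not be integrable, and the Bochner
  integral would then silently be zero; a weak solution must make all these integrals exist.\<close>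

definition weak_solution ::
    "'a::euclidean_space set \<Rightarrow> (nat \<Rightarrow> 'a \<Rightarrow> real) \<Rightarrow>
     (nat \<Rightarrow> 'a \<Rightarrow> real) \<Rightarrow> ('a \<Rightarrow> real) \<Rightarrow> bool" where
  "weak_solution \<Omega> F p \<phi> \<longleftrightarrow>
     pnp_system \<Omega> (H10 \<Omega>) F p \<phi> \<and>
     (\<forall>i\<in>{1,2}. \<forall>v\<in>H10 \<Omega>.
        integrable (lebesgue_on \<Omega>) (\<lambda>x. ((q i * p i x) *\<^sub>R wgrad \<Omega> \<phi> x) \<bullet> wgrad \<Omega> v x))"

definition fe_solution ::
    "'a::euclidean_space set \<Rightarrow> 'a set set \<Rightarrow> (nat \<Rightarrow> 'a \<Rightarrow> real) \<Rightarrow>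
     (nat \<Rightarrow> 'a \<Rightarrow> real) \<Rightarrow> ('a \<Rightarrow> real) \<Rightarrow> bool" where
  "fe_solution \<Omega> \<T> F p \<phi> \<longleftrightarrow> pnp_system \<Omega> (Sh \<Omega> \<T>) F p \<phi>"

definition uniquely_solvable ::
    "'a::euclidean_space set \<Rightarrow> ((nat \<Rightarrow> 'a \<Rightarrow> real) \<Rightarrow> ('a \<Rightarrow> real) \<Rightarrow> bool) \<Rightarrow> bool" where
  "uniquely_solvable \<Omega> sol \<longleftrightarrow>
     (\<exists>p \<phi>. sol p \<phi>) \<and>
     (\<forall>p \<phi> p' \<phi>'. sol p \<phi> \<and> sol p' \<phi>' \<longrightarrow>
        (\<forall>i\<in>{1,2}. AE x in lebesgue_on \<Omega>. p i x = p' i x) \<and>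
        (AE x in lebesgue_on \<Omega>. \<phi> x = \<phi>' x))"

text \<open>Here \<open>pH\<close> is the coarse-grid concentration, and \<open>ps\<close>, \<open>\<phi>s\<close> are the two-grid
  approximations on the fine triangulation \<open>\<T>\<close>.\<close>

definition semi_decoupled_two_grid_solution ::
    "'a::euclidean_space set \<Rightarrow> 'a set set \<Rightarrow> (nat \<Rightarrow> 'a \<Rightarrow> real) \<Rightarrow>
     (nat \<Rightarrow> 'a \<Rightarrow> real) \<Rightarrow> (nat \<Rightarrow> 'a \<Rightarrow> real) \<Rightarrow> ('a \<Rightarrow> real) \<Rightarrow> bool" where
  "semi_decoupled_two_grid_solution \<Omega> \<T> F pH ps \<phi>s \<longleftrightarrow>
     \<phi>s \<in> Sh \<Omega> \<T> \<and>
     (\<forall>w\<in>Sh \<Omega> \<T>. l2_inner \<Omega> (wgrad \<Omega> \<phi>s) (wgrad \<Omega> w)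
        = (\<Sum>i\<in>{1,2}. q i * l2_inner \<Omega> (pH i) w) + l2_inner \<Omega> (F 3) w) \<and>
     (\<forall>i\<in>{1,2}. ps i \<in> Sh \<Omega> \<T>) \<and>
     (\<forall>i\<in>{1,2}. \<forall>v\<in>Sh \<Omega> \<T>.
        l2_inner \<Omega> (wgrad \<Omega> (ps i)) (wgrad \<Omega> v)
        + l2_inner \<Omega> (\<lambda>x. (q i * pH i x) *\<^sub>R wgrad \<Omega> \<phi>s x) (wgrad \<Omega> v)
        = l2_inner \<Omega> (F i) v)"

end

theory Submission
  imports Defs
begin

text \<open>The errors \<open>e = p\<^sub>h - p\<^sub>h\<^sup>*\<close> and \<open>\<eta> = \<phi>\<^sub>h - \<phi>\<^sub>h\<^sup>*\<close> are themselves admissible test functions.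
  Testing the difference of the potential equations with \<open>\<eta>\<close> and using a Poincare inequality
  whose constant depends only on the diameter of \<open>\<Omega>\<close> bounds \<open>\<nabla>\<eta>\<close> by the coarse
  concentration error. In the difference of the concentration equations the drift terms split as
  \<open>p\<^sub>H \<nabla>\<phi>\<^sub>h\<^sup>* - p\<^sub>h \<nabla>\<phi>\<^sub>h = (p\<^sub>H - p\<^sub>h) \<nabla>\<phi>\<^sub>h - p\<^sub>H \<nabla>\<eta>\<close>, and both summands are controlled by
  the \<open>L\<^sup>\<infinity>\<close> bounds on \<open>\<nabla>\<phi>\<^sub>h\<close> and \<open>p\<^sub>H\<close>.

  Since \<open>wgrad\<close> is an arbitrary choice of weak gradient, its linearity rests on almost everywhere
  uniqueness, i.e. on the fundamental lemma of the calculus of variations. For the Poincare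
  inequality, a finite element function extended by zero is continuous and piecewise affine
  along every line, so the fundamental theorem of calculus bounds its square at a point by an
  integral along a segment leaving \<open>\<Omega>\<close>; integrating over the point and using translation
  invariance of the Lebesgue measure finishes the argument without choosing coordinates.\<close>

section \<open>Smooth bump functions\<close>

text \<open>\<open>Ck\<close> is phrased with \<open>frechet_derivative\<close>, which is a choice;
  uniqueness of the derivative allows any explicit formula \<open>f'\<close> to be used in its
  place.\<close>

lemma Ck_SucI:
  assumes "\<And>x. (f has_derivative f' x) (at x)" and "\<And>v. Ck k (\<lambda>x. f' x v)"
  shows "Ck (Suc k) f"
proof -
  have "frechet_derivative f (at x) = f' x" for x
    using frechet_derivative_at[OF assms(1)] by simp
  with assms show ?thesis
    by (auto simp: differentiable_def)
qed

lemma Ck_SucD: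
  assumes "Ck (Suc k) f"
  shows "(f has_derivative frechet_derivative f (at x)) (at x)"
    and "Ck k (\<lambda>x. frechet_derivative f (at x) v)"
  using assms by (auto simp: frechet_derivative_works[symmetric])

lemma Ck_lower: "Ck (Suc k) f \<Longrightarrow> Ck k f"
proof (induction k arbitrary: f)
  case 0
  then show ?case
    by (auto intro!: continuous_at_imp_continuous_on differentiable_imp_continuous_within)
next
  case (Suc k)
  show ?case
    by (rule Ck_SucI[OF Ck_SucD(1)[OF Suc.prems] Suc.IH[OF Ck_SucD(2)[OF Suc.prems]]])
qed

lemma Ck_const: "Ck k (\<lambda>x. c)"
proof (induction k arbitrary: c)
  case (Suc k)
  show ?case by (rule Ck_SucI[OF has_derivative_const Suc.IH])
qed simp

lemma Ck_add: "Ck k f \<Longrightarrow> Ck k g \<Longrightarrow> Ck k (\<lambda>x. f x + g x)"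
proof (induction k arbitrary: f g)
  case (Suc k)
  show ?case
    by (rule Ck_SucI[OF has_derivative_add[OF Ck_SucD(1)[OF Suc.prems(1)] Ck_SucD(1)[OF Suc.prems(2)]]])
      (intro Suc.IH Ck_SucD[OF Suc.prems(1)] Ck_SucD[OF Suc.prems(2)])
qed (simp add: continuous_on_add)

text \<open>The derivative of a product contains the undifferentiated factors as well, so the
  induction also needs them in the lower class, which is what \<open>Ck_lower\<close>
  supplies.\<close>

lemma Ck_mult: "Ck k f \<Longrightarrow> Ck k g \<Longrightarrow> Ck k (\<lambda>x. f x * g x)"
proof (induction k arbitrary: f g)
  case (Suc k)
  show ?case
    by (rule Ck_SucI[OF has_derivative_mult[OF Ck_SucD(1)[OF Suc.prems(1)] Ck_SucD(1)[OF Suc.prems(2)]]])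
      (intro Ck_add Suc.IH Ck_SucD[OF Suc.prems(1)] Ck_SucD[OF Suc.prems(2)] Ck_lower[OF Suc.prems(1)] Ck_lower[OF Suc.prems(2)])
qed (simp add: continuous_on_mult)

lemma Ck_prod:
  assumes "\<And>i. i \<in> S \<Longrightarrow> Ck k (f i)"
  shows "Ck k (\<lambda>x. \<Prod>i\<in>S. f i x)"
  using assms by (induction S rule: infinite_finite_induct) (auto intro: Ck_const Ck_mult)

text \<open>The division by powers of \<open>t\<close> makes the span of the family closed under differentiation.\<close>

definition flat :: "nat \<Rightarrow> real \<Rightarrow> real" where
  "flat k t = (if t \<le> 0 then 0 else exp (- 1 / t) / t ^ k)"

text \<open>On the right, the substitution of \<open>inverse t\<close> turns the claim into the
  decay of a power divided by an exponential; on the left the function is identically zero.\<close>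

lemma flat_tendsto_0: "(flat k \<longlongrightarrow> 0) (at 0)"
proof -
  have "((\<lambda>t. inverse t ^ k / exp (inverse t)) \<longlongrightarrow> (0::real)) (at_right 0)"
    using filterlim_compose[OF tendsto_power_div_exp_0 filterlim_inverse_at_top_right] .
  moreover have "\<forall>\<^sub>F t in at_right 0. inverse t ^ k / exp (inverse t) = flat k t"
    using eventually_at_right_less[of "0::real"]
    by eventually_elim (simp add: flat_def exp_minus field_simps power_inverse)
  ultimately have "(flat k \<longlongrightarrow> 0) (at_right 0)"
    using tendsto_cong by fast
  moreover have "\<forall>\<^sub>F t in at_left 0. flat k t = 0"
    using eventually_at_left_real[of "-1" 0]
    by (rule eventually_mono) (auto simp: flat_def)
  then have "(flat k \<longlongrightarrow> 0) (at_left 0)"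
    by (rule tendsto_eventually)
  ultimately show ?thesis by (simp add: filterlim_at_split)
qed

text \<open>The only delicate point is the origin, where the difference quotient of one member of
  the family is the next member and hence tends to zero.\<close>

lemma flat_has_derivative:
  "(flat k has_real_derivative flat (k + 2) t - k * flat (k + 1) t) (at t)"
proof -
  consider "t < 0" | "t = 0" | "t > 0" by linarith
  then show ?thesis
  proof cases
    case 1
    have "((\<lambda>t. 0) has_real_derivative 0) (at t)" by simp
    then have "(flat k has_real_derivative 0) (at t)"
      by (rule has_field_derivative_transform_within_open[of _ _ _ "{..<0}"])
        (use 1 in \<open>auto simp: flat_def\<close>)
    with 1 show ?thesis by (simp add: flat_def)
  next
    case 2
    \<comment> \<open>This includes \<open>h = 0\<close>, where division by zero and
      \<open>flat\<close> both give 0.\<close>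
    have "(flat k (0 + h) - flat k 0) / h = flat (Suc k) h" for h
      by (simp add: flat_def)
    then have "(flat k has_real_derivative 0) (at 0)"
      using flat_tendsto_0[of "Suc k"] by (simp add: DERIV_def)
    with 2 show ?thesis by (simp add: flat_def)
  next
    case 3
    \<comment> \<open>Writing the derivative with \<open>t ^ k / t\<close> instead of
      \<open>t ^ (k - 1)\<close> avoids truncated subtraction at \<open>k = 0\<close>.\<close>
    have pow: "((\<lambda>t. t ^ k) has_real_derivative k * t ^ k / t) (at t)"
      using 3 DERIV_pow[of k t] by (cases k) auto
    have "((\<lambda>t. exp (- 1 / t) / t ^ k) has_real_derivative
        exp (- 1 / t) / t ^ (k + 2) - k * (exp (- 1 / t) / t ^ (k + 1))) (at t)"
    proof (rule DERIV_cong)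
      show "((\<lambda>t. exp (- 1 / t) / t ^ k) has_real_derivative
          (exp (- 1 / t) * (1 / t\<^sup>2) * t ^ k - exp (- 1 / t) * (k * t ^ k / t)) / (t ^ k * t ^ k)) (at t)"
        by (rule DERIV_divide[OF DERIV_fun_exp pow])
          (use 3 in \<open>auto intro!: derivative_eq_intros simp: power2_eq_square\<close>)
    qed (use 3 in \<open>simp add: field_simps power2_eq_square\<close>)
    then have "(flat k has_real_derivative
        exp (- 1 / t) / t ^ (k + 2) - k * (exp (- 1 / t) / t ^ (k + 1))) (at t)"
      by (rule has_field_derivative_transform_within_open[of _ _ _ "{0<..}"])
        (use 3 in \<open>auto simp: flat_def\<close>)
    with 3 show ?thesis by (simp add: flat_def)
  qed
qed

text \<open>The induction must keep \<open>k\<close> arbitrary, since one differentiation raises the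
  index to \<open>k + 1\<close> and \<open>k + 2\<close>.\<close>

lemma Ck_flat_affine: "Ck m (\<lambda>x. flat k (c \<bullet> x + d))"
proof (induction m arbitrary: k)
  case 0
  have "isCont (flat k) t" for t
    using flat_has_derivative DERIV_isCont by blast
  then have "continuous_on UNIV (flat k)"
    by (simp add: continuous_at_imp_continuous_on)
  then have "continuous_on UNIV (\<lambda>x. flat k (c \<bullet> x + d))"
    by (rule continuous_on_compose2[OF _ continuous_on_add[OF continuous_on_inner]]) simp_all
  then show ?case by simp
next
  case (Suc m)
  have "((\<lambda>x. flat k (c \<bullet> x + d)) has_derivative
      (\<lambda>v. (flat (k + 2) (c \<bullet> x + d) + (- k) * flat (k + 1) (c \<bullet> x + d)) * (c \<bullet> v))) (at x)" for x
  proof -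
    have "((\<lambda>x. c \<bullet> x + d) has_derivative (\<lambda>v. c \<bullet> v)) (at x)"
      by (auto intro!: derivative_eq_intros)
    from has_derivative_compose[OF this flat_has_derivative[unfolded has_field_derivative_def]]
    show ?thesis by simp
  qed
  then show ?case
    by (rule Ck_SucI) (intro Ck_mult Ck_add Ck_const Suc.IH)
qed

lemma flat_bounds: "0 \<le> flat 0 t" "flat 0 t \<le> 1"
  by (auto simp: flat_def)

text \<open>A tensor product of smooth one-sided steps: for \<open>n > 0\<close> it is positive
  exactly on \<open>box a b\<close>, and as \<open>n\<close> grows each step sharpens, so that the
  indicator of the box is a bounded pointwise limit.\<close>

definition bump :: "'a::euclidean_space \<Rightarrow> 'a \<Rightarrow> nat \<Rightarrow> 'a \<Rightarrow> real" where
  "bump a b n x = (\<Prod>i\<in>Basis. flat 0 (real n * (x \<bullet> i - a \<bullet> i)) * flat 0 (real n * (b \<bullet> i - x \<bullet> i)))"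

lemma Ck_bump: "Ck k (bump a b n)"
proof -
  \<comment> \<open>Each factor is brought into the affine form handled by
    \<open>Ck_flat_affine\<close>.\<close>
  have "flat 0 (real n * (x \<bullet> i - a \<bullet> i)) = flat 0 ((real n *\<^sub>R i) \<bullet> x + - real n * (a \<bullet> i))"
    "flat 0 (real n * (b \<bullet> i - x \<bullet> i)) = flat 0 ((- real n *\<^sub>R i) \<bullet> x + real n * (b \<bullet> i))" for i x
    by (simp_all add: algebra_simps inner_commute)
  then have "bump a b n = (\<lambda>x. \<Prod>i\<in>Basis. flat 0 ((real n *\<^sub>R i) \<bullet> x + - real n * (a \<bullet> i)) *
      flat 0 ((- real n *\<^sub>R i) \<bullet> x + real n * (b \<bullet> i)))"
    by (simp add: bump_def fun_eq_iff)
  then show ?thesis by (simp only:) (intro Ck_prod Ck_mult Ck_flat_affine)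
qed

lemma bump_bounds: "0 \<le> bump a b n x" "bump a b n x \<le> 1"
  unfolding bump_def by (auto intro!: prod_nonneg prod_le_1 mult_le_one flat_bounds mult_nonneg_nonneg)

lemma bump_eq_0: "x \<notin> box a b \<Longrightarrow> bump a b n x = 0"
  unfolding bump_def
  by (auto simp: box_def not_less flat_def mult_le_0_iff intro!: prod_zero)

lemma bump_tendsto: "(\<lambda>n. bump a b n x) \<longlonglongrightarrow> indicator (box a b) x"
proof (cases "x \<in> box a b")
  case True
  have lim: "(\<lambda>n. flat 0 (real n * t)) \<longlonglongrightarrow> 1" if "t > 0" for t
  proof -
    have "(\<lambda>n. exp (- (1 / t) * (1 / real n))) \<longlonglongrightarrow> exp (- (1 / t) * 0)"
      by (intro tendsto_intros lim_1_over_n)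
    moreover have "\<forall>\<^sub>F n in sequentially. exp (- (1 / t) * (1 / real n)) = flat 0 (real n * t)"
      using eventually_gt_at_top[of 0] 
      by eventually_elim (use that in \<open>simp add: flat_def mult_le_0_iff field_simps\<close>)
    ultimately show ?thesis by (simp add: tendsto_cong)
  qed
  have "(\<lambda>n. bump a b n x) \<longlonglongrightarrow> (\<Prod>i\<in>(Basis::'a set). 1 * 1)"
    unfolding bump_def by (intro tendsto_prod tendsto_mult lim) (use True in \<open>auto simp: box_def\<close>)
  with True show ?thesis by simp
qed (simp add: bump_eq_0)

text \<open>The closed box serves as the compact set outside which the function vanishes, which is
  why it is the closed box that has to lie in \<open>U\<close>.\<close>

lemma bump_test_function:
  assumes "cbox a b \<subseteq> U"
  shows "bump a b n \<in> test_functions U"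
  unfolding test_functions_def
  using assms bump_eq_0[of _ a b n] box_subset_cbox[of a b]
  by (fastforce intro!: Ck_bump exI[of _ "cbox a b"])

section \<open>The fundamental lemma of the calculus of variations\<close>

text \<open>As \<open>ennreal\<close> truncates negative numbers to 0, \<open>M\<close> and
  \<open>N\<close> have the positive and negative parts of \<open>f\<close> as densities. They agree
  on the intersection-stable generator of boxes, hence everywhere, and densities are almost
  everywhere unique.\<close>

lemma AE_eq_0_if_box_integrals_0:
  fixes f :: "'a::euclidean_space \<Rightarrow> real"
  assumes f: "integrable lborel f"
    and box: "\<And>a b. (\<integral>x. indicator (box a b) x * f x \<partial>lborel) = 0"
  shows "AE x in lborel. f x = 0"
proof -
  have [measurable]: "f \<in> borel_measurable lborel" using f by auto
  define M where "M = density lborel (\<lambda>x. ennreal (f x))"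
  define N where "N = density lborel (\<lambda>x. ennreal (- f x))"
  let ?A = "\<lambda>n::nat. box (- (real n *\<^sub>R One)) (real n *\<^sub>R One) :: 'a set"
  have on_box: "emeasure M (box a b) = emeasure N (box a b) \<and> emeasure M (box a b) \<noteq> \<infinity>" for a b
  proof -
    let ?g = "\<lambda>x. indicator (box a b) x * f x"
    have int: "integrable lborel ?g"
      using integrable_mult_indicator[OF _ f, of "box a b"] by simp
    then have "(\<integral>\<^sup>+x. norm (?g x) \<partial>lborel) < \<infinity>"
      by (simp only: integrable_iff_bounded)
    moreover have "(\<integral>\<^sup>+x. ?g x \<partial>lborel) \<le> (\<integral>\<^sup>+x. norm (?g x) \<partial>lborel)"
      "(\<integral>\<^sup>+x. - ?g x \<partial>lborel) \<le> (\<integral>\<^sup>+x. norm (?g x) \<partial>lborel)"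
      unfolding real_norm_def by (intro nn_integral_mono ennreal_leI abs_ge_self abs_ge_minus_self)+
    ultimately have fin: "(\<integral>\<^sup>+x. ?g x \<partial>lborel) < \<infinity>" "(\<integral>\<^sup>+x. - ?g x \<partial>lborel) < \<infinity>"
      by auto
    have "enn2real (\<integral>\<^sup>+x. ?g x \<partial>lborel) = enn2real (\<integral>\<^sup>+x. - ?g x \<partial>lborel)"
      using real_lebesgue_integral_def[OF int] box by simp
    then have "(\<integral>\<^sup>+x. ?g x \<partial>lborel) = (\<integral>\<^sup>+x. - ?g x \<partial>lborel)"
      using fin by (metis ennreal_enn2real infinity_ennreal_def)
    moreover have "emeasure M (box a b) = (\<integral>\<^sup>+x. ?g x \<partial>lborel)"
      "emeasure N (box a b) = (\<integral>\<^sup>+x. - ?g x \<partial>lborel)"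
      by (auto simp: M_def N_def emeasure_density intro!: nn_integral_cong split: split_indicator)
    ultimately show ?thesis using fin by simp
  qed
  have "M = N"
  proof (rule measure_eqI_generator_eq[where E = "range (\<lambda>(a, b). box a b)" and \<Omega> = UNIV and A = ?A])
    show "Int_stable (range (\<lambda>(a, b). box a b :: 'a set))"
      by (auto simp: Int_stable_def box_Int_box)
    show "(\<Union>i. ?A i) = UNIV" by (rule UN_box_eq_UNIV)
    show "emeasure M (?A i) \<noteq> \<infinity>" for i using on_box by blast
    show "emeasure M X = emeasure N X" if "X \<in> range (\<lambda>(a, b). box a b)" for X
      using that on_box by auto
  qed (auto simp: M_def N_def borel_eq_box)
  \<comment> \<open>One of the two sides is always truncated to 0, so equality makes both
    vanish.\<close>
  then have "AE x in lborel. ennreal (f x) = ennreal (- f x)"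
    unfolding M_def N_def by (subst (asm) sigma_finite_measure.density_unique_iff[OF lborel.sigma_finite_measure_axioms]) auto
  then show ?thesis
    by eventually_elim (metis ennreal_eq_0_iff ennreal_neg linorder_le_cases neg_le_0_iff_le order_antisym)
qed

lemma integral_lebesgue_on_eq_lebesgue:
  fixes f :: "'a::euclidean_space \<Rightarrow> real"
  assumes "open U" "\<And>x. x \<notin> U \<Longrightarrow> f x = 0"
  shows "integral\<^sup>L (lebesgue_on U) f = integral\<^sup>L lebesgue f"
    and "integrable (lebesgue_on U) f \<longleftrightarrow> integrable lebesgue f"
proof -
  have "(\<lambda>x. if x \<in> U then f x else 0) = f" using assms(2) by auto
  then show "integral\<^sup>L (lebesgue_on U) f = integral\<^sup>L lebesgue f"
    "integrable (lebesgue_on U) f \<longleftrightarrow> integrable lebesgue f"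
    using Lebesgue_Measure.integral_restrict_UNIV[of U f] Lebesgue_Measure.integrable_restrict_UNIV[of U f] assms(1) by auto
qed

lemma test_function_eq_0: "\<psi> \<in> test_functions U \<Longrightarrow> x \<notin> U \<Longrightarrow> \<psi> x = 0"
  unfolding test_functions_def by blast

text \<open>Bump functions approximate indicators of boxes, so \<open>w\<close> integrates to zero
  over every box whose closed version lies in \<open>U\<close>. This forces \<open>w\<close> to
  vanish almost everywhere on each such closed box, and countably many of them cover
  \<open>U\<close>.\<close>

lemma fundamental_lemma_calculus_of_variations:
  fixes w :: "'a::euclidean_space \<Rightarrow> real"
  assumes U: "open U" and w: "locally_integrable U w"
    and test: "\<And>\<psi>. \<psi> \<in> test_functions U \<Longrightarrow> integral\<^sup>L (lebesgue_on U) (\<lambda>x. w x * \<psi> x) = 0"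
  shows "AE x in lebesgue_on U. w x = 0"
proof -
  have int: "integrable lebesgue (\<lambda>x. indicator (cbox a b) x * w x)" if "cbox a b \<subseteq> U" for a b
    using w that unfolding locally_integrable_def set_integrable_def by auto
  have int': "integrable lebesgue (\<lambda>x. indicator (box a b) x * w x)" if "cbox a b \<subseteq> U" for a b
  proof -
    have "integrable lebesgue (\<lambda>x. indicator (box a b) x *\<^sub>R (indicator (cbox a b) x * w x))"
      by (rule integrable_mult_indicator[OF _ int[OF that]]) simp
    moreover have "(\<lambda>x. indicator (box a b) x *\<^sub>R (indicator (cbox a b) x * w x)) = (\<lambda>x. indicator (box a b) x * w x)"
      using box_subset_cbox[of a b] by (auto simp: fun_eq_iff split: split_indicator)
    ultimately show ?thesis by simp
  qed
  have box: "(\<integral>x. indicator (box a b) x * w x \<partial>lebesgue) = 0" if sub: "cbox a b \<subseteq> U" for a b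
  proof -
    have *: "indicator (cbox a b) x * w x * bump a b n x = w x * bump a b n x" for n x
      using bump_eq_0[of x a b n] box_subset_cbox[of a b] by (cases "x \<in> box a b") auto
    have bm: "bump a b n \<in> borel_measurable lebesgue" for n
      using Ck_bump[of 0 a b n]
      by (intro measurable_completion) (simp add: borel_measurable_continuous_onI)
    have "(\<lambda>n. \<integral>x. indicator (cbox a b) x * w x * bump a b n x \<partial>lebesgue) \<longlonglongrightarrow>
        (\<integral>x. indicator (cbox a b) x * w x * indicator (box a b) x \<partial>lebesgue)"
    proof (rule integral_dominated_convergence)
      have *: "(\<lambda>x. indicator (cbox a b) x * w x) \<in> borel_measurable lebesgue"
        using int[OF sub] by auto
      show "(\<lambda>x. indicator (cbox a b) x * w x * indicator (box a b) x) \<in> borel_measurable lebesgue"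
        "(\<lambda>x. indicator (cbox a b) x * w x * bump a b n x) \<in> borel_measurable lebesgue" for n
        by (rule borel_measurable_times[OF * borel_measurable_indicator], simp)
          (rule borel_measurable_times[OF * bm])
      show "integrable lebesgue (\<lambda>x. norm (indicator (cbox a b) x * w x))"
        by (rule integrable_norm[OF int[OF sub]])
      show "AE x in lebesgue. (\<lambda>n. indicator (cbox a b) x * w x * bump a b n x) \<longlonglongrightarrow>
          indicator (cbox a b) x * w x * indicator (box a b) x"
        by (intro AE_I2 tendsto_mult tendsto_const bump_tendsto)
      show "AE x in lebesgue. norm (indicator (cbox a b) x * w x * bump a b n x) \<le>
          norm (indicator (cbox a b) x * w x)" for n
        by (intro AE_I2) (use bump_bounds[of a b n] in \<open>simp add: abs_mult mult_left_le\<close>)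
    qed
    moreover have "(\<integral>x. indicator (cbox a b) x * w x * bump a b n x \<partial>lebesgue) = 0" for n
      using test[OF bump_test_function[OF sub, of n]]
        integral_lebesgue_on_eq_lebesgue(1)[OF U, of "\<lambda>x. w x * bump a b n x"]
        test_function_eq_0[OF bump_test_function[OF sub, of n]]
      unfolding * by simp
    ultimately have "(\<integral>x. indicator (cbox a b) x * w x * indicator (box a b) x \<partial>lebesgue) = 0"
      using LIMSEQ_unique[OF _ tendsto_const[of 0]] by simp
    moreover have "(\<lambda>x. indicator (cbox a b) x * w x * indicator (box a b) x) = (\<lambda>x. indicator (box a b) x * w x)"
      using box_subset_cbox[of a b] by (auto simp: fun_eq_iff split: split_indicator)
    ultimately show ?thesis by simp
  qed
  have on_cbox: "AE x in lebesgue. x \<in> cbox a b \<longrightarrow> w x = 0" if sub: "cbox a b \<subseteq> U" for a b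
  proof -
    let ?w = "\<lambda>x. indicator (box a b) x * w x"
    \<comment> \<open>Uniqueness from box integrals is stated for \<open>lborel\<close>, so the
      Lebesgue measurable restriction of \<open>w\<close> is replaced by a Borel
      representative.\<close>
    obtain W where [measurable]: "W \<in> borel_measurable lborel" and W: "AE x in lborel. ?w x = W x"
      using completion_ex_borel_measurable_real[of ?w lborel] int'[OF sub] by auto
    have W': "AE x in lebesgue. ?w x = W x" by (rule AE_completion[OF W])
    have wm: "?w \<in> borel_measurable lebesgue" using int'[OF sub] by auto
    have Wm: "W \<in> borel_measurable lebesgue" by (rule measurable_completion) simp
    have "integrable lebesgue W"
      using integrable_cong_AE[OF _ Wm W'] int'[OF sub] by auto
    then have "integrable lborel W" by (simp add: integrable_completion)
    moreover have "(\<integral>x. indicator (box c d) x * W x \<partial>lborel) = 0" for c d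
    proof -
      have "(\<integral>x. indicator (box c d) x * W x \<partial>lborel) = (\<integral>x. indicator (box c d) x * W x \<partial>lebesgue)"
        by (rule integral_completion[symmetric]) simp
      also have "\<dots> = (\<integral>x. indicator (box c d) x * ?w x \<partial>lebesgue)"
        by (intro integral_cong_AE borel_measurable_times[OF borel_measurable_indicator] Wm wm)
          (use W' in auto)
      also have "\<dots> = (\<integral>x. indicator (box c d \<inter> box a b) x * w x \<partial>lebesgue)"
        by (simp add: indicator_inter_arith mult.assoc)
      also have "\<dots> = 0"
      proof (cases "box c d \<inter> box a b = {}")
        case False
        \<comment> \<open>The intersection is again an open box; being nonempty, its closure is the
          closed box, which stays inside \<open>cbox a b\<close> and therefore inside
          \<open>U\<close>.\<close>
        obtain e f where ef: "box c d \<inter> box a b = box e f" by (simp add: box_Int_box)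
        with False have "cbox e f = closure (box e f)" by simp
        also have "\<dots> \<subseteq> cbox a b"
          by (rule closure_minimal) (use ef box_subset_cbox[of a b] in auto)
        finally show ?thesis using box[of e f] sub ef by auto
      qed simp
      finally show ?thesis .
    qed
    ultimately have "AE x in lborel. W x = 0"
      by (rule AE_eq_0_if_box_integrals_0)
    then have "AE x in lebesgue. W x = 0" by (rule AE_completion)
    \<comment> \<open>Box integrals only see the open box; its boundary is a null set.\<close>
    moreover have "AE x in lebesgue. x \<notin> cbox a b - box a b"
      by (rule AE_not_in) (use negligible_frontier_interval negligible_iff_null_sets in blast)
    ultimately show ?thesis
      using W' by eventually_elim (auto split: split_indicator)
  qed
  obtain \<D> where \<D>: "countable \<D>" "\<D> \<subseteq> Pow U" "\<And>X. X \<in> \<D> \<Longrightarrow> \<exists>a b. X = cbox a b" "\<Union>\<D> = U"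
    using open_countable_Union_open_cbox[OF U] by blast
  have "AE x in lebesgue. \<forall>X\<in>\<D>. x \<in> X \<longrightarrow> w x = 0"
    using \<D>(2,3) on_cbox by (subst AE_ball_countable[OF \<D>(1)]) blast
  then have "AE x in lebesgue. x \<in> U \<longrightarrow> w x = 0"
    by eventually_elim (use \<D>(4) in blast)
  then show ?thesis
    using U by (subst AE_restrict_space_iff) auto
qed

section \<open>Weak gradients\<close>

text \<open>The complement of \<open>K\<close> is open and the function is zero there, so one
  compact set also supports all directional derivatives.\<close>

lemma test_functionE:
  assumes "\<psi> \<in> test_functions U"
  obtains K where "compact K" "K \<subseteq> U" "\<And>x. x \<notin> K \<Longrightarrow> \<psi> x = 0"
    "\<And>x v. x \<notin> K \<Longrightarrow> frechet_derivative \<psi> (at x) v = 0"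
    "continuous_on UNIV \<psi>" "\<And>v. continuous_on UNIV (\<lambda>x. frechet_derivative \<psi> (at x) v)"
    "\<And>x. (\<psi> has_derivative frechet_derivative \<psi> (at x)) (at x)"
proof -
  from assms obtain K where K: "compact K" "K \<subseteq> U" "\<And>x. x \<notin> K \<Longrightarrow> \<psi> x = 0" and ck: "\<And>k. Ck k \<psi>"
    unfolding test_functions_def by blast
  have "frechet_derivative \<psi> (at x) v = 0" if "x \<notin> K" for x v
  proof -
    have "((\<lambda>x. 0) has_derivative (\<lambda>v. 0)) (at x)" by simp
    then have "(\<psi> has_derivative (\<lambda>v. 0)) (at x)"
      by (rule has_derivative_transform_within_open[of _ _ _ _ "- K"])
        (use K that compact_imp_closed in auto)
    from frechet_derivative_at[OF this] show ?thesis by metis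
  qed
  with K show thesis
    using that[of K] ck[of 0] ck[of "Suc 0"] Ck_SucD[of 0 \<psi>] by simp
qed

text \<open>On \<open>K\<close> the continuous factor is bounded and \<open>f\<close> is integrable.
  Leaving the factor general covers test functions and their derivatives alike.\<close>

lemma integrable_mult_compact_support:
  fixes f \<theta> :: "'a::euclidean_space \<Rightarrow> real"
  assumes "open U" "locally_integrable U f" "continuous_on UNIV \<theta>"
    and K: "compact K" "K \<subseteq> U" "\<And>x. x \<notin> K \<Longrightarrow> \<theta> x = 0"
  shows "integrable (lebesgue_on U) (\<lambda>x. f x * \<theta> x)"
proof -
  have int: "integrable lebesgue (\<lambda>x. indicator K x * f x)"
    using assms unfolding locally_integrable_def set_integrable_def by auto
  have "compact (\<theta> ` K)"
    by (meson assms(3) K(1) compact_continuous_image continuous_on_subset subset_UNIV)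
  then obtain B where B: "\<And>x. x \<in> K \<Longrightarrow> \<bar>\<theta> x\<bar> \<le> B"
    using compact_imp_bounded bounded_iff by (metis imageI real_norm_def)
  have eq: "(\<lambda>x. indicator K x * f x * \<theta> x) = (\<lambda>x. f x * \<theta> x)"
    using K(3) by (auto simp: fun_eq_iff split: split_indicator)
  have "\<theta> \<in> borel_measurable lebesgue"
    using assms(3) by (intro measurable_completion) (simp add: borel_measurable_continuous_onI)
  then have "(\<lambda>x. indicator K x * f x * \<theta> x) \<in> borel_measurable lebesgue"
    by (intro borel_measurable_times[OF borel_measurable_integrable[OF int]])
  moreover have "integrable lebesgue (\<lambda>x. B * (indicator K x * f x))"
    using int by simp
  moreover have "norm (indicator K x * f x * \<theta> x) \<le> norm (B * (indicator K x * f x))" for x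
  proof (cases "x \<in> K")
    case True
    then have "\<bar>f x\<bar> * \<bar>\<theta> x\<bar> \<le> \<bar>f x\<bar> * \<bar>B\<bar>"
      using B[of x] by (intro mult_left_mono) auto
    with True show ?thesis by (simp add: abs_mult mult.commute)
  qed simp
  ultimately have "integrable lebesgue (\<lambda>x. indicator K x * f x * \<theta> x)"
    using Bochner_Integration.integrable_bound by blast
  then show ?thesis
    unfolding eq using K assms(1) by (subst integral_lebesgue_on_eq_lebesgue(2)) auto
qed

lemma integrable_mult_test_function:
  fixes f :: "'a::euclidean_space \<Rightarrow> real"
  assumes "open U" "locally_integrable U f" "\<psi> \<in> test_functions U"
  shows "integrable (lebesgue_on U) (\<lambda>x. f x * \<psi> x)"
    and "integrable (lebesgue_on U) (\<lambda>x. f x * frechet_derivative \<psi> (at x) v)"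
proof -
  obtain K where K: "compact K" "K \<subseteq> U" "\<And>x. x \<notin> K \<Longrightarrow> \<psi> x = 0"
    "\<And>x v. x \<notin> K \<Longrightarrow> frechet_derivative \<psi> (at x) v = 0"
    "continuous_on UNIV \<psi>" "\<And>v. continuous_on UNIV (\<lambda>x. frechet_derivative \<psi> (at x) v)"
    using test_functionE[OF assms(3)] by metis
  show "integrable (lebesgue_on U) (\<lambda>x. f x * \<psi> x)"
    by (rule integrable_mult_compact_support[OF assms(1,2) K(5,1,2,3)])
  show "integrable (lebesgue_on U) (\<lambda>x. f x * frechet_derivative \<psi> (at x) v)"
    by (rule integrable_mult_compact_support[OF assms(1,2) K(6,1,2,4)])
qed

lemma locally_integrable_diff:
  "locally_integrable U f \<Longrightarrow> locally_integrable U g \<Longrightarrow> locally_integrable U (\<lambda>x. f x - g x)"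
  unfolding locally_integrable_def by (auto intro: set_integral_diff(1))

lemma locally_integrable_inner:
  "locally_integrable U f \<Longrightarrow> locally_integrable U (\<lambda>x. f x \<bullet> b)"
  unfolding locally_integrable_def by (auto intro: absolutely_integrable_component)

text \<open>Against every test function the components of \<open>g\<close> and \<open>k\<close> give
  the same number, so the fundamental lemma applies to each component of the difference.\<close>

lemma has_weak_gradient_unique:
  assumes U: "open U" and g: "has_weak_gradient U u g" and k: "has_weak_gradient U u k"
  shows "AE x in lebesgue_on U. g x = k x"
proof -
  have "AE x in lebesgue_on U. g x \<bullet> b - k x \<bullet> b = 0" if b: "b \<in> Basis" for b
  proof (rule fundamental_lemma_calculus_of_variations[OF U])
    have gb: "locally_integrable U (\<lambda>x. g x \<bullet> b)" and kb: "locally_integrable U (\<lambda>x. k x \<bullet> b)"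
      using g k by (simp_all add: has_weak_gradient_def locally_integrable_inner)
    then show "locally_integrable U (\<lambda>x. g x \<bullet> b - k x \<bullet> b)"
      by (rule locally_integrable_diff)
    fix \<psi> assume \<psi>: "\<psi> \<in> test_functions U"
    have "integral\<^sup>L (lebesgue_on U) (\<lambda>x. g x \<bullet> b * \<psi> x) = integral\<^sup>L (lebesgue_on U) (\<lambda>x. k x \<bullet> b * \<psi> x)"
    proof -
      have "- integral\<^sup>L (lebesgue_on U) (\<lambda>x. g x \<bullet> b * \<psi> x) = - integral\<^sup>L (lebesgue_on U) (\<lambda>x. k x \<bullet> b * \<psi> x)"
        using g k \<psi> b unfolding has_weak_gradient_def by fastforce
      then show ?thesis by simp
    qed
    then show "integral\<^sup>L (lebesgue_on U) (\<lambda>x. (g x \<bullet> b - k x \<bullet> b) * \<psi> x) = 0"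
      using integrable_mult_test_function(1)[OF U gb \<psi>] integrable_mult_test_function(1)[OF U kb \<psi>]
      by (simp add: left_diff_distrib)
  qed
  then have "AE x in lebesgue_on U. \<forall>b\<in>Basis. g x \<bullet> b - k x \<bullet> b = 0"
    by (subst AE_ball_countable) (auto intro: countable_finite)
  then show ?thesis
    by eventually_elim (auto intro: euclidean_eqI)
qed

lemma has_weak_gradient_diff:
  assumes U: "open U" and u: "has_weak_gradient U u g" and v: "has_weak_gradient U v k"
  shows "has_weak_gradient U (\<lambda>x. u x - v x) (\<lambda>x. g x - k x)"
  unfolding has_weak_gradient_def
proof (intro conjI ballI)
  have li: "locally_integrable U u" "locally_integrable U v" "locally_integrable U g" "locally_integrable U k"
    using u v by (auto simp: has_weak_gradient_def)
  then show "locally_integrable U (\<lambda>x. u x - v x)" "locally_integrable U (\<lambda>x. g x - k x)"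
    by (auto intro: locally_integrable_diff)
  fix \<psi> and b :: 'a assume \<psi>: "\<psi> \<in> test_functions U" and b: "b \<in> Basis"
  note int = integrable_mult_test_function[OF U _ \<psi>]
  show "integral\<^sup>L (lebesgue_on U) (\<lambda>x. (u x - v x) * frechet_derivative \<psi> (at x) b) =
      - integral\<^sup>L (lebesgue_on U) (\<lambda>x. (g x - k x) \<bullet> b * \<psi> x)"
    using u v \<psi> b int(2)[OF li(1)] int(2)[OF li(2)]
      int(1)[OF locally_integrable_inner[OF li(3)]] int(1)[OF locally_integrable_inner[OF li(4)]]
    by (simp add: left_diff_distrib inner_diff_left has_weak_gradient_def)
qed

lemma test_functions_mono: "V \<subseteq> U \<Longrightarrow> test_functions V \<subseteq> test_functions U"
  unfolding test_functions_def by blast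

text \<open>A test function on \<open>V\<close> is already one on \<open>U\<close>, and the
  integrands vanish off \<open>V\<close>.\<close>

lemma has_weak_gradient_subset:
  assumes "open U" "open V" "V \<subseteq> U" and g: "has_weak_gradient U u g"
  shows "has_weak_gradient V u g"
  unfolding has_weak_gradient_def
proof (intro conjI ballI)
  show "locally_integrable V u" "locally_integrable V g"
    using g assms(3) by (auto simp: has_weak_gradient_def locally_integrable_def)
  fix \<psi> and b :: 'a assume \<psi>: "\<psi> \<in> test_functions V" and b: "b \<in> Basis"
  have \<psi>': "\<psi> \<in> test_functions U" using \<psi> test_functions_mono[OF assms(3)] by blast
  have "f x * \<psi> x = 0 \<and> f x * frechet_derivative \<psi> (at x) b = 0" if "x \<notin> V" for f :: "'a \<Rightarrow> real" and x
    using test_functionE[OF \<psi>] that by (metis mult_zero_right subsetD)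
  then have "integral\<^sup>L (lebesgue_on V) (\<lambda>x. f x * \<psi> x) = integral\<^sup>L (lebesgue_on U) (\<lambda>x. f x * \<psi> x)"
    "integral\<^sup>L (lebesgue_on V) (\<lambda>x. f x * frechet_derivative \<psi> (at x) b) =
      integral\<^sup>L (lebesgue_on U) (\<lambda>x. f x * frechet_derivative \<psi> (at x) b)" for f :: "'a \<Rightarrow> real"
    using assms(1-3) by (subst (1 2) integral_lebesgue_on_eq_lebesgue(1); blast)+
  then show "integral\<^sup>L (lebesgue_on V) (\<lambda>x. u x * frechet_derivative \<psi> (at x) b) =
      - integral\<^sup>L (lebesgue_on V) (\<lambda>x. g x \<bullet> b * \<psi> x)"
    using g \<psi>' b unfolding has_weak_gradient_def by simp
qed

section \<open>Integration by parts and weak gradients of affine functions\<close>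

text \<open>A sequence of steps replaces the limit in a real parameter, so that dominated
  convergence and measurability of sequential limits become available.\<close>

lemma difference_quotients_tendsto:
  fixes f :: "'a::real_normed_vector \<Rightarrow> real"
  assumes "((\<lambda>t. f (x + t *\<^sub>R b)) has_real_derivative d) (at 0)"
  shows "(\<lambda>n. real (Suc n) * (f (x + inverse (real (Suc n)) *\<^sub>R b) - f x)) \<longlonglongrightarrow> d"
proof -
  have "((\<lambda>h. (f (x + h *\<^sub>R b) - f x) / h) \<longlongrightarrow> d) (at 0)"
    using assms by (simp add: DERIV_def)
  moreover have "filterlim (\<lambda>n. inverse (real (Suc n))) (at 0) sequentially"
    unfolding filterlim_at using LIMSEQ_inverse_real_of_nat by simp
  ultimately have "(\<lambda>n. (f (x + inverse (real (Suc n)) *\<^sub>R b) - f x) / inverse (real (Suc n))) \<longlonglongrightarrow> d"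
    by (rule filterlim_compose)
  then show ?thesis by (simp add: divide_inverse mult.commute)
qed

lemma has_derivative_along_line:
  fixes f :: "'a::real_normed_vector \<Rightarrow> real"
  assumes "(f has_derivative f') (at (x + t *\<^sub>R b))"
  shows "((\<lambda>t. f (x + t *\<^sub>R b)) has_real_derivative f' b) (at t)"
proof -
  have "((\<lambda>t. x + t *\<^sub>R b) has_derivative (\<lambda>s. s *\<^sub>R b)) (at t)"
    by (auto intro!: derivative_eq_intros)
  from has_derivative_compose[OF this assms]
  show ?thesis
    using linear_scale[OF has_derivative_linear[OF assms]]
    by (simp add: has_field_derivative_def mult_commute_abs)
qed

lemma integral_lborel_translate:
  fixes f :: "'a::euclidean_space \<Rightarrow> real"
  assumes "f \<in> borel_measurable borel"
  shows "(\<integral>x. f (x + c) \<partial>lborel) = (\<integral>x. f x \<partial>lborel)"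
proof -
  have "(\<integral>x. f x \<partial>lborel) = (\<integral>x. f x \<partial>distr lborel borel ((+) c))"
    by (simp add: lborel_distr_plus)
  also have "\<dots> = (\<integral>x. f (c + x) \<partial>lborel)"
    by (rule integral_distr) (use assms in auto)
  finally show ?thesis by (simp add: add.commute)
qed

lemma integrable_lborel_continuous_compact_support:
  fixes f :: "'a::euclidean_space \<Rightarrow> real"
  assumes "continuous_on UNIV f" "compact K" "\<And>x. x \<notin> K \<Longrightarrow> f x = 0"
  shows "integrable lborel f"
proof -
  have "(\<lambda>x. indicator K x *\<^sub>R f x) = f"
    using assms(3) by (auto simp: fun_eq_iff split: split_indicator)
  then show ?thesis
    using borel_integrable_compact[OF assms(2), of f] continuous_on_subset[OF assms(1)]
    by (metis subset_UNIV)
qed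

text \<open>By translation invariance each difference quotient integrates to zero; the mean value
  theorem bounds the quotients uniformly, so this passes to the limit.\<close>

lemma integral_derivative_compact_support:
  fixes f :: "'a::euclidean_space \<Rightarrow> real"
  assumes der: "\<And>x. (f has_derivative f' x) (at x)" and cont: "continuous_on UNIV (\<lambda>x. f' x b)"
    and K: "compact K" and f0: "\<And>x. x \<notin> K \<Longrightarrow> f x = 0" and f'0: "\<And>x. x \<notin> K \<Longrightarrow> f' x b = 0"
  shows "(\<integral>x. f' x b \<partial>lborel) = 0"
proof -
  let ?d = "\<lambda>n x. real (Suc n) * (f (x + inverse (real (Suc n)) *\<^sub>R b) - f x)"
  have contf: "continuous_on UNIV f"
    using der by (intro continuous_at_imp_continuous_on ballI has_derivative_continuous)
  then have fm: "f \<in> borel_measurable borel" by (rule borel_measurable_continuous_onI)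
  have intf: "integrable lborel f"
    by (rule integrable_lborel_continuous_compact_support[OF contf K f0])
  have "compact ((\<lambda>x. f' x b) ` K)"
    by (rule compact_continuous_image[OF continuous_on_subset[OF cont subset_UNIV] K])
  then obtain B where "\<forall>y\<in>(\<lambda>x. f' x b) ` K. norm y \<le> B"
    using compact_imp_bounded bounded_iff by metis
  \<comment> \<open>The maximum guards against a negative \<open>B\<close>, which is possible when
    \<open>K\<close> is empty.\<close>
  then have B: "\<bar>f' x b\<bar> \<le> max B 0" for x
    by (cases "x \<in> K") (auto simp: f'0)
  obtain R where R: "\<And>x. x \<in> K \<Longrightarrow> norm x \<le> R"
    using K compact_imp_bounded bounded_iff by metis
  \<comment> \<open>The steps have length at most \<open>norm b\<close>, so outside this ball
    neither \<open>x\<close> nor its translate meets \<open>K\<close>.\<close>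
  let ?C = "cball 0 (R + norm b) :: 'a set"
  have dbound: "norm (?d n x) \<le> indicator ?C x * max B 0" for n x
  proof -
    let ?s = "inverse (real (Suc n))"
    have s: "0 < ?s" "?s \<le> 1" by (auto simp: field_simps)
    show ?thesis
    proof (cases "x \<in> ?C")
      case True
      obtain z where "f (x + ?s *\<^sub>R b) - f (x + 0 *\<^sub>R b) = (?s - 0) * f' (x + z *\<^sub>R b) b"
        using MVT2[OF s(1), of "\<lambda>t. f (x + t *\<^sub>R b)" "\<lambda>t. f' (x + t *\<^sub>R b) b"]
          has_derivative_along_line[OF der] by blast
      then have "?d n x = f' (x + z *\<^sub>R b) b" by simp
      then show ?thesis using B[of "x + z *\<^sub>R b"] True by simp
    next
      case False
      have "norm (?s *\<^sub>R b) \<le> norm b" using s by (simp add: mult_left_le_one_le)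
      moreover have "norm x \<le> norm (x + ?s *\<^sub>R b) + norm (?s *\<^sub>R b)"
        by (metis add_diff_cancel norm_triangle_ineq4)
      ultimately have "norm (x + ?s *\<^sub>R b) > R" "norm x > R"
        using False norm_ge_zero[of b] by (auto simp del: norm_scaleR norm_ge_zero)
      then have "f (x + ?s *\<^sub>R b) = 0" "f x = 0" using R f0 by fastforce+
      then show ?thesis by simp
    qed
  qed
  have "(\<lambda>n. \<integral>x. ?d n x \<partial>lborel) \<longlonglongrightarrow> (\<integral>x. f' x b \<partial>lborel)"
  proof (rule integral_dominated_convergence)
    show "(\<lambda>x. f' x b) \<in> borel_measurable lborel" "?d n \<in> borel_measurable lborel" for n
      using fm cont by (auto intro: borel_measurable_continuous_onI)
    show "integrable lborel (\<lambda>x. indicator ?C x * max B 0)"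
      by (intro integrable_mult_left integrable_real_indicator) (use emeasure_bounded_finite[of ?C] in simp_all)
    show "AE x in lborel. (\<lambda>n. ?d n x) \<longlonglongrightarrow> f' x b"
      by (intro AE_I2 difference_quotients_tendsto has_derivative_along_line) (simp add: der)
  qed (use dbound in simp)
  moreover have "(\<integral>x. ?d n x \<partial>lborel) = 0" for n
  proof -
    have "integrable lborel (\<lambda>x. f (x + inverse (real (Suc n)) *\<^sub>R b))"
      using intf lborel_distr_plus[of "inverse (real (Suc n)) *\<^sub>R b"] fm
        integrable_distr_eq[of "(+) (inverse (real (Suc n)) *\<^sub>R b)" lborel borel f]
      by (simp add: add.commute)
    then show ?thesis
      using intf integral_lborel_translate[OF fm] by simp
  qed
  ultimately show ?thesis using LIMSEQ_unique[OF _ tendsto_const[of 0]] by simp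
qed

text \<open>The product of the affine function and a test function has compact support, so its
  derivative along \<open>b\<close> integrates to zero; the product rule then gives the
  identity.\<close>

lemma has_weak_gradient_affine:
  assumes V: "open V" and u: "\<And>x. x \<in> V \<Longrightarrow> u x = a + c \<bullet> x"
  shows "has_weak_gradient V u (\<lambda>_. c)"
  unfolding has_weak_gradient_def
proof (intro conjI ballI)
  have loc: "locally_integrable V f"
    if "\<And>x. x \<in> V \<Longrightarrow> f x = g x" "continuous_on UNIV g" for f g :: "'a \<Rightarrow> 'b::euclidean_space"
    unfolding locally_integrable_def set_integrable_def
  proof (intro allI impI)
    fix K assume K: "compact K \<and> K \<subseteq> V"
    then have "integrable lborel (\<lambda>x. indicator K x *\<^sub>R g x)"
      using borel_integrable_compact[of K g] continuous_on_subset[OF that(2)] by blast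
    then have "integrable lebesgue (\<lambda>x. indicator K x *\<^sub>R g x)"
      by (simp add: integrable_completion)
    moreover have "(\<lambda>x. indicator K x *\<^sub>R g x) = (\<lambda>x. indicator K x *\<^sub>R f x)"
      using K that(1) by (auto simp: fun_eq_iff split: split_indicator)
    ultimately show "integrable lebesgue (\<lambda>x. indicator K x *\<^sub>R f x)" by simp
  qed
  show "locally_integrable V u" by (rule loc[OF u]) (auto intro!: continuous_intros)
  show "locally_integrable V (\<lambda>_. c)" by (rule loc) auto
  fix \<psi> and b :: 'a assume \<psi>: "\<psi> \<in> test_functions V" and b: "b \<in> Basis"
  let ?D = "\<lambda>x. frechet_derivative \<psi> (at x)"
  let ?A = "\<lambda>x. (a + c \<bullet> x) * ?D x b" and ?B = "\<lambda>x. (c \<bullet> b) * \<psi> x"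
  obtain K where K: "compact K" "K \<subseteq> V" "\<And>x. x \<notin> K \<Longrightarrow> \<psi> x = 0" "\<And>x v. x \<notin> K \<Longrightarrow> ?D x v = 0"
    and cont: "continuous_on UNIV \<psi>" "\<And>v. continuous_on UNIV (\<lambda>x. ?D x v)"
    and der: "\<And>x. (\<psi> has_derivative ?D x) (at x)"
    using test_functionE[OF \<psi>] by metis
  have contAB: "continuous_on UNIV ?A" "continuous_on UNIV ?B"
    by (intro continuous_intros cont)+
  have intAB: "integrable lborel ?A" "integrable lborel ?B"
    by (rule integrable_lborel_continuous_compact_support[OF contAB(1) K(1)], simp add: K)
      (rule integrable_lborel_continuous_compact_support[OF contAB(2) K(1)], simp add: K)
  have "((\<lambda>x. (a + c \<bullet> x) * \<psi> x) has_derivative (\<lambda>v. (a + c \<bullet> x) * ?D x v + (c \<bullet> v) * \<psi> x)) (at x)" for x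
    by (rule has_derivative_mult[OF _ der]) (auto intro!: derivative_eq_intros)
  from integral_derivative_compact_support[OF this, of b K]
  have "(\<integral>x. ?A x + ?B x \<partial>lborel) = 0"
    using K contAB by (simp add: continuous_on_add)
  then have "(\<integral>x. ?A x \<partial>lborel) = - (\<integral>x. ?B x \<partial>lborel)"
    using intAB by simp
  moreover have "f \<in> borel_measurable lborel" if "continuous_on UNIV f" for f :: "'a \<Rightarrow> real"
    using that by (simp add: borel_measurable_continuous_onI)
  ultimately have "integral\<^sup>L lebesgue ?A = - integral\<^sup>L lebesgue ?B"
    using contAB cont(1) by (simp add: integral_completion)
  moreover have "integral\<^sup>L (lebesgue_on V) ?A = integral\<^sup>L lebesgue ?A"
    "integral\<^sup>L (lebesgue_on V) ?B = integral\<^sup>L lebesgue ?B"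
    using K by (intro integral_lebesgue_on_eq_lebesgue[OF V]; auto)+
  moreover have "integral\<^sup>L (lebesgue_on V) (\<lambda>x. u x * ?D x b) = integral\<^sup>L (lebesgue_on V) ?A"
    by (rule Bochner_Integration.integral_cong) (auto simp: u)
  ultimately show "integral\<^sup>L (lebesgue_on V) (\<lambda>x. u x * ?D x b) =
      - integral\<^sup>L (lebesgue_on V) (\<lambda>x. c \<bullet> b * \<psi> x)"
    by (simp only:)
qed

section \<open>Square integrable functions\<close>

lemma l2_inner_self: "l2_inner \<Omega> u u = integral\<^sup>L (lebesgue_on \<Omega>) (\<lambda>x. (norm (u x))\<^sup>2)"
  by (simp add: l2_inner_def dot_square_norm)

lemma l2_inner_self_nonneg: "0 \<le> l2_inner \<Omega> u u"
  by (simp add: l2_inner_self)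

lemma l2_norm_nonneg: "0 \<le> l2_norm \<Omega> u"
  by (simp add: l2_norm_def l2_inner_self_nonneg)

lemma l2_norm_power2: "(l2_norm \<Omega> u)\<^sup>2 = l2_inner \<Omega> u u"
  by (simp add: l2_norm_def l2_inner_self_nonneg)

lemma L2_integrable_inner:
  assumes "u \<in> L2 \<Omega>" "v \<in> L2 \<Omega>"
  shows "integrable (lebesgue_on \<Omega>) (\<lambda>x. u x \<bullet> v x)"
proof -
  have "integrable (lebesgue_on \<Omega>) (\<lambda>x. (norm (u x))\<^sup>2 + (norm (v x))\<^sup>2)"
    using assms by (auto simp: L2_def)
  moreover have "(\<lambda>x. u x \<bullet> v x) \<in> borel_measurable (lebesgue_on \<Omega>)"
    using assms by (auto simp: L2_def)
  moreover have "norm (u x \<bullet> v x) \<le> norm ((norm (u x))\<^sup>2 + (norm (v x))\<^sup>2)" for x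
    using Cauchy_Schwarz_ineq2[of "u x" "v x"] sum_squares_bound[of "norm (u x)" "norm (v x)"]
      mult_nonneg_nonneg[OF norm_ge_zero[of "u x"] norm_ge_zero[of "v x"]]
    by simp
  ultimately show ?thesis
    using Bochner_Integration.integrable_bound by blast
qed

lemma L2_diff:
  assumes "u \<in> L2 \<Omega>" "v \<in> L2 \<Omega>"
  shows "(\<lambda>x. u x - v x) \<in> L2 \<Omega>"
proof -
  have "(norm (u x - v x))\<^sup>2 = (norm (u x))\<^sup>2 - 2 * (u x \<bullet> v x) + (norm (v x))\<^sup>2" for x
    by (simp add: power2_norm_eq_inner inner_diff inner_commute)
  then show ?thesis
    using assms L2_integrable_inner[OF assms] by (auto simp: L2_def)
qed

lemma l2_inner_diff_left:
  assumes "u \<in> L2 \<Omega>" "v \<in> L2 \<Omega>" "w \<in> L2 \<Omega>"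
  shows "l2_inner \<Omega> (\<lambda>x. u x - v x) w = l2_inner \<Omega> u w - l2_inner \<Omega> v w"
  unfolding l2_inner_def
  using L2_integrable_inner[OF assms(1,3)] L2_integrable_inner[OF assms(2,3)]
  by (simp add: inner_diff_left)

lemma l2_inner_cong_AE:
  assumes "u \<in> L2 \<Omega>" "u' \<in> L2 \<Omega>" "v \<in> L2 \<Omega>" "AE x in lebesgue_on \<Omega>. u x = u' x"
  shows "l2_inner \<Omega> u v = l2_inner \<Omega> u' v"
  unfolding l2_inner_def
proof (rule integral_cong_AE)
  show "AE x in lebesgue_on \<Omega>. u x \<bullet> v x = u' x \<bullet> v x"
    using assms(4) by eventually_elim simp
qed (use assms in \<open>auto simp: L2_def\<close>)

lemma l2_Cauchy_Schwarz:
  assumes "u \<in> L2 \<Omega>" "v \<in> L2 \<Omega>"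
  shows "\<bar>l2_inner \<Omega> u v\<bar> \<le> l2_norm \<Omega> u * l2_norm \<Omega> v"
proof -
  let ?M = "lebesgue_on \<Omega>" and ?u = "\<lambda>x. norm (u x)" and ?v = "\<lambda>x. norm (v x)"
  have [measurable]: "u \<in> borel_measurable ?M" "v \<in> borel_measurable ?M"
    and int: "integrable ?M (\<lambda>x. (?u x)\<^sup>2)" "integrable ?M (\<lambda>x. (?v x)\<^sup>2)"
    using assms by (auto simp: L2_def)
  have "?u \<in> L2 \<Omega>" "?v \<in> L2 \<Omega>" using assms by (auto simp: L2_def)
  then have intuv: "integrable ?M (\<lambda>x. ?u x * ?v x)"
    using L2_integrable_inner[of ?u \<Omega> ?v] by simp
  have "(\<integral>\<^sup>+x. ennreal (?u x) * ennreal (?v x) \<partial>?M)\<^sup>2 \<le>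
      (\<integral>\<^sup>+x. (ennreal (?u x))\<^sup>2 \<partial>?M) * (\<integral>\<^sup>+x. (ennreal (?v x))\<^sup>2 \<partial>?M)"
    by (rule Cauchy_Schwarz_nn_integral) auto
  then have "ennreal ((\<integral>x. ?u x * ?v x \<partial>?M)\<^sup>2) \<le> ennreal ((\<integral>x. (?u x)\<^sup>2 \<partial>?M) * (\<integral>x. (?v x)\<^sup>2 \<partial>?M))"
    using nn_integral_eq_integral[OF intuv] nn_integral_eq_integral[OF int(1)] nn_integral_eq_integral[OF int(2)]
    by (simp add: ennreal_mult[symmetric] ennreal_power)
  then have "(\<integral>x. ?u x * ?v x \<partial>?M)\<^sup>2 \<le> (l2_norm \<Omega> u * l2_norm \<Omega> v)\<^sup>2"
    by (simp add: power_mult_distrib l2_norm_power2 l2_inner_self)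
  then have "(\<integral>x. ?u x * ?v x \<partial>?M) \<le> l2_norm \<Omega> u * l2_norm \<Omega> v"
    by (rule power2_le_imp_le) (simp add: l2_norm_nonneg)
  moreover have "\<bar>l2_inner \<Omega> u v\<bar> \<le> (\<integral>x. \<bar>u x \<bullet> v x\<bar> \<partial>?M)"
    unfolding l2_inner_def by (rule integral_abs_bound)
  moreover have "(\<integral>x. \<bar>u x \<bullet> v x\<bar> \<partial>?M) \<le> (\<integral>x. ?u x * ?v x \<partial>?M)"
    using L2_integrable_inner[OF assms] intuv Cauchy_Schwarz_ineq2
    by (intro integral_mono) auto
  ultimately show ?thesis by linarith
qed

text \<open>Squaring the pointwise bound gives both claims at once. It serves for drift terms, where
  one factor is essentially bounded, and with \<open>c = 1\<close> for changing
  representatives.\<close>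

lemma L2_dominated:
  assumes w: "w \<in> borel_measurable (lebesgue_on \<Omega>)" and u: "u \<in> L2 \<Omega>" and "0 \<le> c"
    and le: "AE x in lebesgue_on \<Omega>. norm (w x) \<le> c * norm (u x)"
  shows "w \<in> L2 \<Omega>" and "l2_norm \<Omega> w \<le> c * l2_norm \<Omega> u"
proof -
  let ?M = "lebesgue_on \<Omega>"
  have int: "integrable ?M (\<lambda>x. c\<^sup>2 * (norm (u x))\<^sup>2)" using u by (auto simp: L2_def)
  have le2: "AE x in ?M. (norm (w x))\<^sup>2 \<le> c\<^sup>2 * (norm (u x))\<^sup>2"
    using le
  proof eventually_elim
    case (elim x)
    from power_mono[OF this, of 2] show ?case by (simp add: power_mult_distrib)
  qed
  have wint: "integrable ?M (\<lambda>x. (norm (w x))\<^sup>2)"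
    by (rule Bochner_Integration.integrable_bound[OF int]) (use w le2 in auto)
  with w show "w \<in> L2 \<Omega>" by (simp add: L2_def)
  have "l2_inner \<Omega> w w \<le> c\<^sup>2 * l2_inner \<Omega> u u"
    unfolding l2_inner_self using integral_mono_AE[OF wint int le2] by simp
  then have "(l2_norm \<Omega> w)\<^sup>2 \<le> (c * l2_norm \<Omega> u)\<^sup>2"
    by (simp add: l2_norm_power2 power_mult_distrib)
  then show "l2_norm \<Omega> w \<le> c * l2_norm \<Omega> u"
    by (rule power2_le_imp_le) (simp add: assms(3) l2_norm_nonneg)
qed

lemma Linf_AE_bound:
  assumes "linf_norm \<Omega> u \<le> ereal M"
  shows "AE x in lebesgue_on \<Omega>. norm (u x) \<le> M"
proof -
  have "AE x in lebesgue_on \<Omega>. ereal (norm (u x)) \<le> linf_norm \<Omega> u"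
    unfolding linf_norm_def by (rule esssup_AE)
  then show ?thesis
    by eventually_elim (use assms order_trans ereal_less_eq(3) in blast)
qed

text \<open>Completeness of Lebesgue measure lets measurability pass to almost everywhere equal
  functions, as needed for the representative chosen by \<open>wgrad\<close>.\<close>

lemma borel_measurable_lebesgue_on_AE:
  fixes f g :: "'a::euclidean_space \<Rightarrow> 'b::euclidean_space"
  assumes "\<Omega> \<in> sets lebesgue" "f \<in> borel_measurable (lebesgue_on \<Omega>)" "AE x in lebesgue_on \<Omega>. f x = g x"
  shows "g \<in> borel_measurable (lebesgue_on \<Omega>)"
proof -
  have "AE x in lebesgue. x \<in> \<Omega> \<longrightarrow> f x = g x"
    using assms by (subst (asm) AE_restrict_space_iff) auto
  then have "AE x in lebesgue. indicator \<Omega> x *\<^sub>R f x = indicator \<Omega> x *\<^sub>R g x"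
    by eventually_elim (auto split: split_indicator)
  moreover have "(\<lambda>x. indicator \<Omega> x *\<^sub>R f x) \<in> borel_measurable lebesgue"
    using assms by (subst (asm) borel_measurable_restrict_space_iff) auto
  ultimately have "(\<lambda>x. indicator \<Omega> x *\<^sub>R g x) \<in> borel_measurable lebesgue"
    by (rule borel_measurable_AE[rotated])
  then show ?thesis
    using assms by (subst borel_measurable_restrict_space_iff) auto
qed

section \<open>Finite element functions\<close>

lemma has_weak_gradient_wgrad: "has_weak_gradient \<Omega> u g \<Longrightarrow> has_weak_gradient \<Omega> u (wgrad \<Omega> u)"
  unfolding wgrad_def by (rule someI[where P = "has_weak_gradient \<Omega> u"])

lemma H1_has_weak_gradient: "u \<in> H1 \<Omega> \<Longrightarrow> has_weak_gradient \<Omega> u (wgrad \<Omega> u)"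
  by (auto simp: H1_def intro: has_weak_gradient_wgrad)

text \<open>The difference of the chosen gradients is a weak gradient of the difference, so by
  uniqueness it agrees almost everywhere with the one \<open>wgrad\<close> selects, which inherits
  measurability and square integrability.\<close>

lemma
  assumes \<Omega>: "open \<Omega>" and u: "u \<in> H1 \<Omega>" and v: "v \<in> H1 \<Omega>"
  shows H1_diff: "(\<lambda>x. u x - v x) \<in> H1 \<Omega>"
    and AE_wgrad_diff: "AE x in lebesgue_on \<Omega>. wgrad \<Omega> u x - wgrad \<Omega> v x = wgrad \<Omega> (\<lambda>x. u x - v x) x"
proof -
  let ?w = "\<lambda>x. u x - v x" and ?g = "\<lambda>x. wgrad \<Omega> u x - wgrad \<Omega> v x"
  have g: "has_weak_gradient \<Omega> ?w ?g"
    by (rule has_weak_gradient_diff[OF \<Omega> H1_has_weak_gradient[OF u] H1_has_weak_gradient[OF v]])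
  then have "has_weak_gradient \<Omega> ?w (wgrad \<Omega> ?w)"
    by (rule has_weak_gradient_wgrad)
  from has_weak_gradient_unique[OF \<Omega> g this]
  show ae: "AE x in lebesgue_on \<Omega>. ?g x = wgrad \<Omega> ?w x" .
  have gL2: "?g \<in> L2 \<Omega>" using u v by (auto simp: H1_def intro: L2_diff)
  have "wgrad \<Omega> ?w \<in> L2 \<Omega>"
  proof (rule L2_dominated[OF _ gL2, of _ 1])
    show "wgrad \<Omega> ?w \<in> borel_measurable (lebesgue_on \<Omega>)"
      by (rule borel_measurable_lebesgue_on_AE[OF _ _ ae]) (use \<Omega> gL2 in \<open>auto simp: L2_def\<close>)
    show "AE x in lebesgue_on \<Omega>. norm (wgrad \<Omega> ?w x) \<le> 1 * norm (?g x)"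
      using ae by eventually_elim simp
  qed simp
  then show "?w \<in> H1 \<Omega>"
    using g u v by (auto simp: H1_def intro: L2_diff)
qed

lemma l2_inner_wgrad_diff:
  assumes \<Omega>: "open \<Omega>" and u: "u \<in> H1 \<Omega>" and v: "v \<in> H1 \<Omega>" and w: "w \<in> L2 \<Omega>"
  shows "l2_inner \<Omega> (wgrad \<Omega> (\<lambda>x. u x - v x)) w = l2_inner \<Omega> (wgrad \<Omega> u) w - l2_inner \<Omega> (wgrad \<Omega> v) w"
proof -
  have L2: "wgrad \<Omega> u \<in> L2 \<Omega>" "wgrad \<Omega> v \<in> L2 \<Omega>" "wgrad \<Omega> (\<lambda>x. u x - v x) \<in> L2 \<Omega>"
    using u v H1_diff[OF \<Omega> u v] by (auto simp: H1_def)
  show ?thesis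
    using l2_inner_cong_AE[OF L2_diff[OF L2(1,2)] L2(3) w AE_wgrad_diff[OF \<Omega> u v]]
      l2_inner_diff_left[OF L2(1,2) w] by simp
qed

lemma Sh_diff:
  assumes \<Omega>: "open \<Omega>" and u: "u \<in> Sh \<Omega> \<T>" and v: "v \<in> Sh \<Omega> \<T>"
  shows "(\<lambda>x. u x - v x) \<in> Sh \<Omega> \<T>"
proof -
  have "\<exists>a b. \<forall>x\<in>e. u x - v x = a + b \<bullet> x" if e: "e \<in> \<T>" for e
  proof -
    obtain a b a' b' where "\<forall>x\<in>e. u x = a + b \<bullet> x" "\<forall>x\<in>e. v x = a' + b' \<bullet> x"
      using u v e by (fastforce simp: Sh_def)
    then have "\<forall>x\<in>e. u x - v x = (a - a') + (b - b') \<bullet> x" by (simp add: inner_diff_left)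
    then show ?thesis by blast
  qed
  with u v H1_diff[OF \<Omega>, of u v] show ?thesis by (simp add: Sh_def)
qed

text \<open>Restricted to the open set \<open>interior e \<inter> \<Omega>\<close>, both the chosen
  gradient and the constant \<open>c\<close> are weak gradients of the same affine function.\<close>

lemma wgrad_Sh_on_element:
  assumes \<Omega>: "open \<Omega>" and v: "v \<in> Sh \<Omega> \<T>" and c: "\<And>x. x \<in> e \<Longrightarrow> v x = a + c \<bullet> x"
  shows "AE x in lebesgue. x \<in> interior e \<inter> \<Omega> \<longrightarrow> wgrad \<Omega> v x = c"
proof -
  let ?V = "interior e \<inter> \<Omega>"
  have V: "open ?V" using \<Omega> by auto
  have "has_weak_gradient ?V v (wgrad \<Omega> v)"
    using has_weak_gradient_subset[OF \<Omega> V _ H1_has_weak_gradient] v by (simp add: Sh_def)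
  moreover have "has_weak_gradient ?V v (\<lambda>_. c)"
    by (rule has_weak_gradient_affine[OF V, of _ a]) (use c interior_subset in blast)
  ultimately have "AE x in lebesgue_on ?V. wgrad \<Omega> v x = c"
    by (rule has_weak_gradient_unique[OF V])
  then show ?thesis
    using V by (subst (asm) AE_restrict_space_iff) auto
qed

lemma
  assumes \<T>: "triangulation_of \<Omega> \<T>"
  shows triangulation_of_finite: "finite \<T>"
    and triangulation_of_element: "e \<in> \<T> \<Longrightarrow> compact e" "e \<in> \<T> \<Longrightarrow> convex e"
    and triangulation_of_Union: "\<Union>\<T> = closure \<Omega>"
  using \<T> unfolding triangulation_of_def triangulation_def
  by (auto intro: compact_simplex convex_simplex)

text \<open>Affine pieces on finitely many closed sets paste together, being restrictions of a
  single function.\<close>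

lemma Sh_continuous_on:
  assumes \<T>: "triangulation_of \<Omega> \<T>" and v: "v \<in> Sh \<Omega> \<T>"
  shows "continuous_on (closure \<Omega>) v"
proof -
  have "continuous_on (\<Union>e\<in>\<T>. e) v"
  proof (rule continuous_on_closed_Union)
    show "finite \<T>" by (rule triangulation_of_finite[OF \<T>])
    show "closed e" if "e \<in> \<T>" for e
      using triangulation_of_element(1)[OF \<T> that] by (rule compact_imp_closed)
    show "continuous_on e v" if e: "e \<in> \<T>" for e
    proof -
      obtain a b where ab: "\<forall>x\<in>e. v x = a + b \<bullet> x" using v e unfolding Sh_def by blast
      have "continuous_on e (\<lambda>x. a + b \<bullet> x)" by (intro continuous_intros)
      then show ?thesis using ab by (simp cong: continuous_on_cong)
    qed
  qed
  then show ?thesis by (simp add: triangulation_of_Union[OF \<T>])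
qed

section \<open>The Poincare inequality\<close>

text \<open>The weights of Young's inequality are chosen so that, after averaging over a segment of length
  \<open>D\<close>, the term \<open>u\<^sup>2 / (2 * D)\<close> is absorbed into the left-hand side.\<close>

lemma sq_le_nn_integral_along_line:
  fixes u :: "real \<Rightarrow> real"
  assumes D: "D > 0" and cont: "continuous_on UNIV u" and S: "finite S"
    and der: "\<And>t. t \<notin> S \<Longrightarrow> (u has_real_derivative g t) (at t)"
    and g: "g \<in> borel_measurable borel" and uD: "u D = 0"
  shows "ennreal ((u 0)\<^sup>2) \<le> (\<integral>\<^sup>+t. indicator {0..D} t * ennreal ((u t)\<^sup>2 / (2 * D) + 2 * D * (g t)\<^sup>2) \<partial>lborel)"
    (is "_ \<le> ?I")
proof (cases "?I < \<infinity>")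
  case True
  let ?h = "\<lambda>t. (u t)\<^sup>2 / (2 * D) + 2 * D * (g t)\<^sup>2"
  have [measurable]: "u \<in> borel_measurable borel" "g \<in> borel_measurable borel"
    using cont g by (auto intro: borel_measurable_continuous_onI)
  have I: "?I = (\<integral>\<^sup>+t. ennreal (indicator {0..D} t * ?h t) \<partial>lborel)"
    by (intro nn_integral_cong) (auto split: split_indicator)
  obtain r where r: "?I = ennreal r" "0 \<le> r"
    using True by (cases ?I rule: ennreal_cases) auto
  have "((\<lambda>t. indicator {0..D} t * ?h t) has_integral r) UNIV"
  proof (rule nn_integral_has_integral)
    show "0 \<le> indicator {0..D} t * ?h t" for t
      using D by (auto intro!: mult_nonneg_nonneg add_nonneg_nonneg)
  qed (use r I in auto)
  moreover have "(\<lambda>t. indicator {0..D} t * ?h t) = (\<lambda>t. if t \<in> {0..D} then ?h t else 0)"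
    by (auto simp: fun_eq_iff)
  ultimately have h: "(?h has_integral r) {0..D}"
    using has_integral_restrict_UNIV[of "{0..D}" ?h r] by simp
  \<comment> \<open>The fundamental theorem is applied to the square of \<open>u\<close>, with the
    finite set \<open>S\<close> as exceptional points; the endpoint \<open>D\<close> contributes
    nothing.\<close>
  have "((\<lambda>t. 2 * u t * g t) has_integral ((u D)\<^sup>2 - (u 0)\<^sup>2)) {0..D}"
  proof (rule fundamental_theorem_of_calculus_interior_strong[OF S])
    show "((\<lambda>t. (u t)\<^sup>2) has_vector_derivative 2 * u t * g t) (at t)" if "t \<in> {0<..<D} - S" for t
      unfolding has_real_derivative_iff_has_vector_derivative[symmetric]
      using that by (auto intro!: derivative_eq_intros der)
    show "continuous_on {0..D} (\<lambda>t. (u t)\<^sup>2)"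
      by (intro continuous_intros continuous_on_subset[OF cont]) simp
  qed (use D in simp)
  from has_integral_neg[OF this] have neg: "((\<lambda>t. - (2 * u t * g t)) has_integral (u 0)\<^sup>2) {0..D}"
    by (simp add: uD)
  have "(u 0)\<^sup>2 \<le> r"
  proof (rule has_integral_le[OF neg h])
    fix t
    have "0 \<le> (u t + 2 * D * g t)\<^sup>2 / (2 * D)" using D by simp
    \<comment> \<open>Expanding this square is Young's inequality with weight
      \<open>2 * D\<close>.\<close>
    also have "\<dots> = ?h t + 2 * u t * g t"
      using D by (simp add: field_simps power2_eq_square)
    finally show "- (2 * u t * g t) \<le> ?h t" by simp
  qed
  then show ?thesis using r by (simp add: ennreal_leI)
qed (auto simp: not_less top_unique)

section \<open>Averaging over segments by translation invariance\<close>

lemma nn_integral_lborel_translate: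
  fixes f :: "'a::euclidean_space \<Rightarrow> ennreal"
  assumes [measurable]: "f \<in> borel_measurable borel"
  shows "(\<integral>\<^sup>+x. f (x + c) \<partial>lborel) = (\<integral>\<^sup>+x. f x \<partial>lborel)"
proof -
  have "(\<integral>\<^sup>+x. f x \<partial>lborel) = (\<integral>\<^sup>+x. f x \<partial>distr lborel borel ((+) c))"
    by (simp add: lborel_distr_plus)
  also have "\<dots> = (\<integral>\<^sup>+x. f (c + x) \<partial>lborel)"
    by (rule nn_integral_distr) auto
  finally show ?thesis by (simp add: add.commute)
qed

text \<open>After exchanging the integrals, every translate of \<open>f\<close> has the same
  integral, and \<open>t\<close> ranges over an interval of length \<open>D\<close>.\<close>

lemma nn_integral_average_along_line:
  fixes f :: "'a::euclidean_space \<Rightarrow> ennreal"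
  assumes [measurable]: "f \<in> borel_measurable borel" and "0 \<le> D"
  shows "(\<integral>\<^sup>+x. (\<integral>\<^sup>+t. indicator {0..D} t * f (x + t *\<^sub>R b) \<partial>lborel) \<partial>lborel) = ennreal D * (\<integral>\<^sup>+x. f x \<partial>lborel)"
proof -
  have "(\<integral>\<^sup>+x. (\<integral>\<^sup>+t. indicator {0..D} t * f (x + t *\<^sub>R b) \<partial>lborel) \<partial>lborel) =
      (\<integral>\<^sup>+t. (\<integral>\<^sup>+x. indicator {0..D} t * f (x + t *\<^sub>R b) \<partial>lborel) \<partial>(lborel :: real measure))"
    by (rule lborel_pair.Fubini'[symmetric]) measurable
  also have "\<dots> = (\<integral>\<^sup>+t. indicator {0..D} t * (\<integral>\<^sup>+x. f x \<partial>lborel) \<partial>lborel)"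
    by (intro nn_integral_cong) (simp add: nn_integral_cmult nn_integral_lborel_translate)
  also have "\<dots> = ennreal D * (\<integral>\<^sup>+x. f x \<partial>lborel)"
    using assms(2) by (simp add: nn_integral_multc)
  finally show ?thesis .
qed

text \<open>Such a set is a closed interval, possibly empty. Hence a line enters or leaves each
  element only finitely often.\<close>

lemma finite_frontier_compact_convex_real:
  fixes T :: "real set"
  assumes "compact T" "convex T"
  shows "finite (frontier T)"
proof -
  obtain a b where "T = {a..b}"
    using assms connected_compact_interval_1 convex_connected by (metis cbox_interval)
  then show ?thesis by (cases "a \<le> b") (auto simp: frontier_def interior_atLeastAtMost_real)
qed

text \<open>The constant is twice the segment length \<open>2 * R\<close> and does not involve the
  triangulation; this is what makes the final estimate uniform in the mesh.\<close>

lemma Sh_Poincare: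
  fixes \<Omega> :: "'a::euclidean_space set"
  assumes \<Omega>: "open \<Omega>" and R: "\<Omega> \<subseteq> ball 0 R" "R > 0"
    and \<T>: "triangulation_of \<Omega> \<T>" and v: "v \<in> Sh \<Omega> \<T>"
  shows "l2_norm \<Omega> v \<le> 4 * R * l2_norm \<Omega> (wgrad \<Omega> v)"
proof -
  obtain b :: 'a where b: "b \<in> Basis" using nonempty_Basis by blast
  \<comment> \<open>A step of length \<open>2 * R\<close> from a point of the ball of radius
    \<open>R\<close> ends outside the ball.\<close>
  define D where "D = 2 * R"
  have D: "D > 0" using R by (simp add: D_def)

  \<comment> \<open>Extension by zero and its affine pieces\<close>
  define w where "w x = (if x \<in> closure \<Omega> then v x else 0)" for x
  \<comment> \<open>As a limit of difference quotients the derivative along \<open>b\<close> is Borel measurable for free.\<close>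
  define g where "g x = lim (\<lambda>n. real (Suc n) * (w (x + inverse (real (Suc n)) *\<^sub>R b) - w x))" for x
  note elem = triangulation_of_element[OF \<T>] and fin = triangulation_of_finite[OF \<T>]
    and Un = triangulation_of_Union[OF \<T>]
  obtain \<alpha> \<gamma> where aff: "\<And>e x. e \<in> \<T> \<Longrightarrow> x \<in> e \<Longrightarrow> v x = \<alpha> e + \<gamma> e \<bullet> x"
    using v unfolding Sh_def by (auto dest!: bchoice)
  have w_aff: "w x = \<alpha> e + \<gamma> e \<bullet> x" if "e \<in> \<T>" "x \<in> e" for e x
    using that aff Un by (auto simp: w_def)
  have w_out: "w x = 0" if "x \<notin> \<Omega>" for x
    using that v \<Omega> by (auto simp: w_def Sh_def frontier_def interior_open)
  have cl: "closure \<Omega> \<subseteq> cball 0 R"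
    using R by (intro closure_minimal) auto
  have contw: "continuous_on UNIV w"
  proof -
    have "continuous_on (closure \<Omega> \<union> - \<Omega>) (\<lambda>x. if x \<in> closure \<Omega> then v x else 0)"
      by (intro continuous_on_cases Sh_continuous_on[OF \<T> v] continuous_on_const)
        (use \<Omega> v in \<open>auto simp: Sh_def frontier_def interior_open\<close>)
    moreover have "closure \<Omega> \<union> - \<Omega> = UNIV" using closure_subset by auto
    ultimately show ?thesis by (simp add: w_def[abs_def])
  qed
  then have wm [measurable]: "w \<in> borel_measurable borel" by (rule borel_measurable_continuous_onI)
  have gm [measurable]: "g \<in> borel_measurable borel"
    unfolding g_def[abs_def] by (rule borel_measurable_lim_metric) measurable

  \<comment> \<open>The derivative along lines\<close>
  have g_eq: "g (x + t *\<^sub>R b) = d" if "((\<lambda>t. w (x + t *\<^sub>R b)) has_real_derivative d) (at t)" for x t d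
  proof -
    have "((\<lambda>s. w ((x + t *\<^sub>R b) + s *\<^sub>R b)) has_real_derivative d) (at 0)"
      using that DERIV_shift[of "\<lambda>t. w (x + t *\<^sub>R b)" d 0 t] by (simp add: algebra_simps)
    from limI[OF difference_quotients_tendsto[OF this]] show ?thesis by (simp add: g_def)
  qed
  have line_elem: "((\<lambda>t. w (x + t *\<^sub>R b)) has_real_derivative \<gamma> e \<bullet> b) (at t)"
    if "e \<in> \<T>" "t \<in> interior {t. x + t *\<^sub>R b \<in> e}" for e x t
  proof (rule has_field_derivative_transform_within_open[of "\<lambda>t. \<alpha> e + \<gamma> e \<bullet> (x + t *\<^sub>R b)"])
    show "((\<lambda>t. \<alpha> e + \<gamma> e \<bullet> (x + t *\<^sub>R b)) has_real_derivative \<gamma> e \<bullet> b) (at t)"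
      by (auto intro!: derivative_eq_intros simp: inner_add_right)
    show "\<alpha> e + \<gamma> e \<bullet> (x + s *\<^sub>R b) = w (x + s *\<^sub>R b)" if "s \<in> interior {t. x + t *\<^sub>R b \<in> e}" for s
      using that interior_subset w_aff[OF \<open>e \<in> \<T>\<close>] by force
  qed (use that in auto)
  have line_out: "((\<lambda>t. w (x + t *\<^sub>R b)) has_real_derivative 0) (at t)"
    if "x + t *\<^sub>R b \<notin> closure \<Omega>" for x t
  proof (rule has_field_derivative_transform_within_open[of "\<lambda>t. 0"])
    have "open ((\<lambda>t. x + t *\<^sub>R b) -` (- closure \<Omega>))"
      by (intro open_vimage continuous_intros) auto
    then show "open {t. x + t *\<^sub>R b \<notin> closure \<Omega>}" by (simp add: vimage_def)
  qed (use that in \<open>auto simp: w_def\<close>)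
  have g_elem: "g x = \<gamma> e \<bullet> b" if "e \<in> \<T>" "x \<in> interior e" for e x
  proof -
    have "open ((\<lambda>t. x + t *\<^sub>R b) -` interior e)"
      by (intro open_vimage continuous_intros) auto
    then have "0 \<in> interior {t. x + t *\<^sub>R b \<in> e}"
      using that(2) interior_subset[of e] by (intro interiorI[of "(\<lambda>t. x + t *\<^sub>R b) -` interior e"]) auto
    from g_eq[OF line_elem[OF that(1) this]] show ?thesis by simp
  qed
  have g_out: "g x = 0" if "x \<notin> closure \<Omega>" for x
    using g_eq[OF line_out[of x 0]] that by simp

  \<comment> \<open>The estimate on a single segment\<close>
  have line: "ennreal ((w x)\<^sup>2) \<le>
      (\<integral>\<^sup>+t. indicator {0..D} t * ennreal ((w (x + t *\<^sub>R b))\<^sup>2 / (2 * D) + 2 * D * (g (x + t *\<^sub>R b))\<^sup>2) \<partial>lborel)" for x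
  proof (cases "x \<in> \<Omega>")
    case True
    \<comment> \<open>The frontier is taken of the parameter set on the line. The parameters at
      which the line meets the frontier of \<open>e\<close> could form an interval, since the line
      may run inside a face.\<close>
    define S where "S = (\<Union>e\<in>\<T>. frontier {t. x + t *\<^sub>R b \<in> e})"
    have closed_line: "closed {t. x + t *\<^sub>R b \<in> e}" if "e \<in> \<T>" for e
    proof -
      have "closed ((\<lambda>t. x + t *\<^sub>R b) -` e)"
        by (intro closed_vimage continuous_intros compact_imp_closed elem(1) that)
      then show ?thesis by (simp add: vimage_def)
    qed
    have "finite (frontier {t. x + t *\<^sub>R b \<in> e})" if e: "e \<in> \<T>" for e
    proof (rule finite_frontier_compact_convex_real)
      have "bounded {t. x + t *\<^sub>R b \<in> e}"
      proof -
        obtain B where B: "\<And>y. y \<in> e \<Longrightarrow> norm y \<le> B"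
          using compact_imp_bounded[OF elem(1)[OF e]] bounded_iff by metis
        have "\<bar>t\<bar> \<le> B + norm x" if "x + t *\<^sub>R b \<in> e" for t
          using B[OF that] norm_triangle_ineq4[of "x + t *\<^sub>R b" x] b by simp
        then show ?thesis unfolding bounded_iff by auto
      qed
      then show "compact {t. x + t *\<^sub>R b \<in> e}"
        using closed_line[OF e] by (simp add: compact_eq_bounded_closed)
      show "convex {t. x + t *\<^sub>R b \<in> e}"
      proof (rule convexI)
        fix s t p q :: real assume *: "s \<in> {t. x + t *\<^sub>R b \<in> e}" "t \<in> {t. x + t *\<^sub>R b \<in> e}" "0 \<le> p" "0 \<le> q" "p + q = 1"
        then have "p *\<^sub>R (x + s *\<^sub>R b) + q *\<^sub>R (x + t *\<^sub>R b) \<in> e"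
          using convexD[OF elem(2)[OF e]] by simp
        moreover have "p *\<^sub>R (x + s *\<^sub>R b) + q *\<^sub>R (x + t *\<^sub>R b) = x + (p * s + q * t) *\<^sub>R b"
          using scaleR_add_left[of p q x] *(5) by (simp add: algebra_simps)
        ultimately show "p *\<^sub>R s + q *\<^sub>R t \<in> {t. x + t *\<^sub>R b \<in> e}" by simp
      qed
    qed
    then have "finite S" using fin by (simp add: S_def)
    moreover have "((\<lambda>t. w (x + t *\<^sub>R b)) has_real_derivative g (x + t *\<^sub>R b)) (at t)" if t: "t \<notin> S" for t
    proof -
      have "\<exists>d. ((\<lambda>t. w (x + t *\<^sub>R b)) has_real_derivative d) (at t)"
      proof (cases "x + t *\<^sub>R b \<in> closure \<Omega>")
        case True
        then obtain e where e: "e \<in> \<T>" "x + t *\<^sub>R b \<in> e" using Un by blast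
        \<comment> \<open>The parameter set is closed and contains \<open>t\<close>, which is not on
          its frontier.\<close>
        then have "t \<in> interior {t. x + t *\<^sub>R b \<in> e}"
          using t closed_line[OF e(1)] by (auto simp: S_def frontier_def)
        then show ?thesis using line_elem[OF e(1)] by blast
      qed (use line_out in blast)
      then show ?thesis using g_eq by blast
    qed
    moreover have "continuous_on UNIV (\<lambda>t. w (x + t *\<^sub>R b))"
      by (rule continuous_on_compose2[OF contw]) (auto intro!: continuous_intros)
    moreover have "w (x + D *\<^sub>R b) = 0"
    proof (rule w_out)
      have "norm (D *\<^sub>R b) \<le> norm (x + D *\<^sub>R b) + norm x"
        using norm_triangle_ineq4[of "x + D *\<^sub>R b" x] by simp
      moreover have "norm x < R" using True R by auto
      ultimately have "norm (x + D *\<^sub>R b) > R" using b D by (simp add: D_def)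
      then show "x + D *\<^sub>R b \<notin> \<Omega>" using R by force
    qed
    ultimately show ?thesis
      using sq_le_nn_integral_along_line[OF D, of "\<lambda>t. w (x + t *\<^sub>R b)" S "\<lambda>t. g (x + t *\<^sub>R b)"] by simp
  qed (simp add: w_out)

  \<comment> \<open>Integration over the starting point of the segment\<close>
  define X where "X = (\<integral>\<^sup>+x. ennreal ((w x)\<^sup>2) \<partial>lborel)"
  define Y where "Y = (\<integral>\<^sup>+x. ennreal ((g x)\<^sup>2) \<partial>lborel)"
  have "X \<le> (\<integral>\<^sup>+x. (\<integral>\<^sup>+t. indicator {0..D} t * ennreal ((w (x + t *\<^sub>R b))\<^sup>2 / (2 * D) + 2 * D * (g (x + t *\<^sub>R b))\<^sup>2) \<partial>lborel) \<partial>lborel)"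
    unfolding X_def by (rule nn_integral_mono) (rule line)
  also have "\<dots> = ennreal D * (\<integral>\<^sup>+x. ennreal ((w x)\<^sup>2 / (2 * D) + 2 * D * (g x)\<^sup>2) \<partial>lborel)"
    by (rule nn_integral_average_along_line) (use D in auto)
  also have "(\<integral>\<^sup>+x. ennreal ((w x)\<^sup>2 / (2 * D) + 2 * D * (g x)\<^sup>2) \<partial>lborel) =
      (\<integral>\<^sup>+x. ennreal (1 / (2 * D)) * ennreal ((w x)\<^sup>2) + ennreal (2 * D) * ennreal ((g x)\<^sup>2) \<partial>lborel)"
    using D by (intro nn_integral_cong) (simp add: ennreal_mult[symmetric] ennreal_plus[symmetric] del: ennreal_plus)
  also have "\<dots> = ennreal (1 / (2 * D)) * X + ennreal (2 * D) * Y"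
    by (simp add: nn_integral_add nn_integral_cmult X_def Y_def)
  finally have XY: "X \<le> ennreal D * (ennreal (1 / (2 * D)) * X + ennreal (2 * D) * Y)" .

  \<comment> \<open>Comparison with the norms on the domain\<close>
  have nn: "ennreal (l2_inner \<Omega> u u) = (\<integral>\<^sup>+x. ennreal ((norm (u x))\<^sup>2) * indicator \<Omega> x \<partial>lebesgue)"
    if "u \<in> L2 \<Omega>" for u :: "'a \<Rightarrow> 'b::euclidean_space"
  proof -
    have "ennreal (l2_inner \<Omega> u u) = (\<integral>\<^sup>+x. ennreal ((norm (u x))\<^sup>2) \<partial>lebesgue_on \<Omega>)"
      unfolding l2_inner_self using that by (intro nn_integral_eq_integral[symmetric]) (auto simp: L2_def)
    also have "\<dots> = (\<integral>\<^sup>+x. ennreal ((norm (u x))\<^sup>2) * indicator \<Omega> x \<partial>lebesgue)"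
      using \<Omega> by (subst nn_integral_restrict_space) auto
    finally show ?thesis .
  qed
  have X: "X = ennreal (l2_inner \<Omega> v v)"
  proof -
    have "X = (\<integral>\<^sup>+x. ennreal ((w x)\<^sup>2) \<partial>lebesgue)"
      by (simp add: X_def nn_integral_completion)
    also have "\<dots> = (\<integral>\<^sup>+x. ennreal ((norm (v x))\<^sup>2) * indicator \<Omega> x \<partial>lebesgue)"
    proof (rule nn_integral_cong)
      show "ennreal ((w x)\<^sup>2) = ennreal ((norm (v x))\<^sup>2) * indicator \<Omega> x" for x
        using closure_subset[of \<Omega>] w_out[of x] by (cases "x \<in> \<Omega>") (auto simp: w_def)
    qed
    also have "\<dots> = ennreal (l2_inner \<Omega> v v)"
      using v by (intro nn[symmetric]) (auto simp: Sh_def H1_def)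
    finally show ?thesis .
  qed
  have Y: "Y \<le> ennreal (l2_inner \<Omega> (wgrad \<Omega> v) (wgrad \<Omega> v))"
  proof -
    \<comment> \<open>Frontiers of convex sets are null, so almost every point of the closed domain
      is interior to some element.\<close>
    have "AE x in lebesgue. \<forall>e\<in>\<T>. x \<notin> frontier e"
    proof (subst AE_ball_countable)
      show "countable \<T>" using fin by (rule countable_finite)
      show "\<forall>e\<in>\<T>. AE x in lebesgue. x \<notin> frontier e"
        using negligible_convex_frontier[OF elem(2)] negligible_iff_null_sets AE_not_in by blast
    qed
    moreover have "AE x in lebesgue. \<forall>e\<in>\<T>. x \<in> interior e \<inter> \<Omega> \<longrightarrow> wgrad \<Omega> v x = \<gamma> e"
      using fin wgrad_Sh_on_element[OF \<Omega> v aff] by (subst AE_ball_countable) (auto intro: countable_finite)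
    \<comment> \<open>\<open>v\<close> vanishes on \<open>frontier \<Omega>\<close>, so the part of the frontier inside an element lies in a hyperplane
      unless the gradient is zero there.\<close>
    moreover have "AE x in lebesgue. \<forall>e\<in>\<T>. \<gamma> e \<noteq> 0 \<longrightarrow> \<gamma> e \<bullet> x \<noteq> - \<alpha> e"
    proof (subst AE_ball_countable)
      show "countable \<T>" using fin by (rule countable_finite)
      show "\<forall>e\<in>\<T>. AE x in lebesgue. \<gamma> e \<noteq> 0 \<longrightarrow> \<gamma> e \<bullet> x \<noteq> - \<alpha> e"
      proof
        fix e
        show "AE x in lebesgue. \<gamma> e \<noteq> 0 \<longrightarrow> \<gamma> e \<bullet> x \<noteq> - \<alpha> e"
        proof (cases "\<gamma> e = 0")
          case False
          then have "{x. \<gamma> e \<bullet> x = - \<alpha> e} \<in> null_sets lebesgue"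
            using negligible_hyperplane[of "\<gamma> e" "- \<alpha> e"] negligible_iff_null_sets by blast
          from AE_not_in[OF this] show ?thesis by eventually_elim simp
        qed simp
      qed
    qed
    ultimately have ae: "AE x in lebesgue. ennreal ((g x)\<^sup>2) \<le> ennreal ((norm (wgrad \<Omega> v x))\<^sup>2) * indicator \<Omega> x"
    proof eventually_elim
      case (elim x)
      show ?case
      proof (cases "x \<in> closure \<Omega>")
        case True
        then obtain e where e: "e \<in> \<T>" "x \<in> e" using Un by blast
        then have int: "x \<in> interior e"
          using elim(1) closure_subset[of e] by (auto simp: frontier_def)
        show ?thesis
        proof (cases "x \<in> \<Omega>")
          case True
          then have "\<bar>g x\<bar> \<le> norm (wgrad \<Omega> v x)"
            using elim(2) e(1) int g_elem[OF e(1) int] Basis_le_norm[OF b, of "\<gamma> e"] by auto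
          then have "(g x)\<^sup>2 \<le> (norm (wgrad \<Omega> v x))\<^sup>2"
            using power_mono[of "\<bar>g x\<bar>" _ 2] by simp
          with True show ?thesis by (simp add: ennreal_leI)
        next
          case False
          then have "\<gamma> e \<bullet> x = - \<alpha> e" using w_out w_aff[OF e] by fastforce
          then show ?thesis using elim(3) e(1) g_elem[OF e(1) int] by auto
        qed
      qed (simp add: g_out)
    qed
    have "Y = (\<integral>\<^sup>+x. ennreal ((g x)\<^sup>2) \<partial>lebesgue)"
      by (simp add: Y_def nn_integral_completion)
    also have "\<dots> \<le> (\<integral>\<^sup>+x. ennreal ((norm (wgrad \<Omega> v x))\<^sup>2) * indicator \<Omega> x \<partial>lebesgue)"
      by (rule nn_integral_mono_AE[OF ae])
    also have "\<dots> = ennreal (l2_inner \<Omega> (wgrad \<Omega> v) (wgrad \<Omega> v))"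
      using v by (intro nn[symmetric]) (auto simp: Sh_def H1_def)
    finally show ?thesis .
  qed

  \<comment> \<open>Absorption into the left-hand side\<close>
  define p where "p = l2_inner \<Omega> v v"
  define r where "r = l2_inner \<Omega> (wgrad \<Omega> v) (wgrad \<Omega> v)"
  have pr: "0 \<le> p" "0 \<le> r" by (simp_all add: p_def r_def l2_inner_self_nonneg)
  have "ennreal p \<le> ennreal D * (ennreal (1 / (2 * D)) * ennreal p + ennreal (2 * D) * ennreal r)"
    using XY Y unfolding X p_def[symmetric] r_def[symmetric]
    by (elim order_trans) (intro mult_left_mono add_left_mono; simp)
  also have "\<dots> = ennreal (D * (1 / (2 * D) * p + 2 * D * r))"
    using D pr by (simp add: ennreal_mult[symmetric] ennreal_plus[symmetric] del: ennreal_plus)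
  finally have "p \<le> D * (1 / (2 * D) * p + 2 * D * r)"
    using D pr by (subst (asm) ennreal_le_iff) auto
  \<comment> \<open>Since \<open>p\<close> is a real number, half of it can be subtracted from both
    sides.\<close>
  also have "\<dots> = p / 2 + 2 * D\<^sup>2 * r"
    using D by (simp add: field_simps power2_eq_square)
  finally have "p \<le> (2 * D)\<^sup>2 * r" by (simp add: power_mult_distrib)
  then have "(l2_norm \<Omega> v)\<^sup>2 \<le> (4 * R * l2_norm \<Omega> (wgrad \<Omega> v))\<^sup>2"
    by (simp add: l2_norm_power2 power_mult_distrib p_def r_def D_def)
  then show ?thesis
    by (rule power2_le_imp_le) (use R in \<open>simp add: l2_norm_nonneg\<close>)
qed

section \<open>The two-grid error\<close>

text \<open>Continuity on the compact closure gives some bound. It may depend on \<open>v\<close>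
  and the mesh and only secures square integrability of drift terms; it does not enter the error
  constant.\<close>

lemma Sh_AE_bounded:
  fixes \<Omega> :: "'a::euclidean_space set"
  assumes \<Omega>: "bounded \<Omega>" and \<T>: "triangulation_of \<Omega> \<T>" and v: "v \<in> Sh \<Omega> \<T>"
  obtains B where "0 \<le> B" "AE x in lebesgue_on \<Omega>. norm (v x) \<le> B"
proof -
  have "compact (v ` closure \<Omega>)"
    using Sh_continuous_on[OF \<T> v] \<Omega> by (intro compact_continuous_image) auto
  then obtain B where "\<forall>y\<in>v ` closure \<Omega>. norm y \<le> B"
    using compact_imp_bounded bounded_iff by metis
  then have "norm (v x) \<le> max B 0" if "x \<in> \<Omega>" for x
    using that closure_subset[of \<Omega>] by fastforce
  then show thesis
    by (intro that[of "max B 0"] AE_I2) auto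
qed

lemma abs_q: "\<bar>q i\<bar> = 1"
  by (simp add: q_def)

text \<open>One pair of meshes with its solutions. The constant of the error estimate is built from
  \<open>R\<close> and \<open>M\<close> alone, so these are parameters to be chosen before the
  meshes.\<close>

locale two_grid =
  fixes \<Omega> :: "'a::euclidean_space set" and \<T> \<T>' :: "'a set set" and F p P ps :: "nat \<Rightarrow> 'a \<Rightarrow> real"
    and \<phi> \<Phi> \<phi>s :: "'a \<Rightarrow> real" and R M :: real
  assumes \<Omega>: "open \<Omega>" and R: "\<Omega> \<subseteq> ball 0 R" "R > 0"
    and \<T>: "triangulation_of \<Omega> \<T>" and \<T>': "triangulation_of \<Omega> \<T>'"
    and fine: "fe_solution \<Omega> \<T> F p \<phi>" and coarse: "fe_solution \<Omega> \<T>' F P \<Phi>"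
    and semi: "semi_decoupled_two_grid_solution \<Omega> \<T> F P ps \<phi>s"
    and M: "0 \<le> M" and grad_\<phi>: "AE x in lebesgue_on \<Omega>. norm (wgrad \<Omega> \<phi> x) \<le> M"
    and P_bound: "\<And>i. i \<in> {1, 2} \<Longrightarrow> AE x in lebesgue_on \<Omega>. norm (P i x) \<le> M"
begin

lemma in_Sh:
  "i \<in> {1, 2} \<Longrightarrow> p i \<in> Sh \<Omega> \<T>" "i \<in> {1, 2} \<Longrightarrow> P i \<in> Sh \<Omega> \<T>'" "i \<in> {1, 2} \<Longrightarrow> ps i \<in> Sh \<Omega> \<T>"
  "\<phi> \<in> Sh \<Omega> \<T>" "\<phi>s \<in> Sh \<Omega> \<T>"
  using fine coarse semi
  unfolding fe_solution_def pnp_system_def semi_decoupled_two_grid_solution_def by blast+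

lemma Sh_L2: "v \<in> Sh \<Omega> S \<Longrightarrow> v \<in> L2 \<Omega>" "v \<in> Sh \<Omega> S \<Longrightarrow> wgrad \<Omega> v \<in> L2 \<Omega>" "v \<in> Sh \<Omega> S \<Longrightarrow> v \<in> H1 \<Omega>"
  by (auto simp: Sh_def H1_def)

abbreviation err :: real where
  "err \<equiv> \<Sum>j\<in>{1, 2}. l2_norm \<Omega> (\<lambda>x. p j x - P j x)"

lemma concentration_diff_L2: "i \<in> {1, 2} \<Longrightarrow> (\<lambda>x. p i x - P i x) \<in> L2 \<Omega>"
  by (rule L2_diff[OF Sh_L2(1)[OF in_Sh(1)] Sh_L2(1)[OF in_Sh(2)]])

text \<open>Subtracting the two potential equations cancels \<open>F 3\<close>; the factor
  \<open>4 * R\<close> is the Poincare constant applied to the error as test function.\<close>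

lemma potential_error: "l2_norm \<Omega> (wgrad \<Omega> (\<lambda>x. \<phi> x - \<phi>s x)) \<le> 4 * R * err"
proof -
  let ?e = "\<lambda>x. \<phi> x - \<phi>s x"
  let ?n = "l2_norm \<Omega> (wgrad \<Omega> ?e)"
  have e: "?e \<in> Sh \<Omega> \<T>" by (rule Sh_diff[OF \<Omega> in_Sh(4,5)])
  have d: "l2_inner \<Omega> (\<lambda>x. p i x - P i x) ?e = l2_inner \<Omega> (p i) ?e - l2_inner \<Omega> (P i) ?e" if "i \<in> {1, 2}" for i
    by (rule l2_inner_diff_left[OF Sh_L2(1)[OF in_Sh(1)[OF that]] Sh_L2(1)[OF in_Sh(2)[OF that]] Sh_L2(1)[OF e]])
  have "?n\<^sup>2 = l2_inner \<Omega> (wgrad \<Omega> \<phi>) (wgrad \<Omega> ?e) - l2_inner \<Omega> (wgrad \<Omega> \<phi>s) (wgrad \<Omega> ?e)"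
    unfolding l2_norm_power2
    by (rule l2_inner_wgrad_diff[OF \<Omega> Sh_L2(3)[OF in_Sh(4)] Sh_L2(3)[OF in_Sh(5)] Sh_L2(2)[OF e]])
  also have "\<dots> = (\<Sum>i\<in>{1,2}. q i * l2_inner \<Omega> (\<lambda>x. p i x - P i x) ?e)"
  proof -
    have "l2_inner \<Omega> (wgrad \<Omega> \<phi>) (wgrad \<Omega> ?e) = (\<Sum>i\<in>{1,2}. q i * l2_inner \<Omega> (p i) ?e) + l2_inner \<Omega> (F 3) ?e"
      "l2_inner \<Omega> (wgrad \<Omega> \<phi>s) (wgrad \<Omega> ?e) = (\<Sum>i\<in>{1,2}. q i * l2_inner \<Omega> (P i) ?e) + l2_inner \<Omega> (F 3) ?e"
      using fine semi e
      unfolding fe_solution_def pnp_system_def semi_decoupled_two_grid_solution_def by blast+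
    then show ?thesis by (simp add: d right_diff_distrib)
  qed
  also have "\<dots> \<le> (\<Sum>i\<in>{1,2}. l2_norm \<Omega> (\<lambda>x. p i x - P i x) * l2_norm \<Omega> ?e)"
  proof (rule sum_mono)
    fix i :: nat assume i: "i \<in> {1, 2}"
    have "q i * l2_inner \<Omega> (\<lambda>x. p i x - P i x) ?e \<le> \<bar>l2_inner \<Omega> (\<lambda>x. p i x - P i x) ?e\<bar>"
      using abs_q[of i] by (metis abs_ge_self abs_mult mult_1)
    also have "\<dots> \<le> l2_norm \<Omega> (\<lambda>x. p i x - P i x) * l2_norm \<Omega> ?e"
      by (rule l2_Cauchy_Schwarz[OF concentration_diff_L2[OF i] Sh_L2(1)[OF e]])
    finally show "q i * l2_inner \<Omega> (\<lambda>x. p i x - P i x) ?e \<le> l2_norm \<Omega> (\<lambda>x. p i x - P i x) * l2_norm \<Omega> ?e" .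
  qed
  also have "\<dots> = err * l2_norm \<Omega> ?e"
    by (simp only: sum_distrib_right)
  also have "\<dots> \<le> err * (4 * R * ?n)"
    by (intro mult_left_mono Sh_Poincare[OF \<Omega> R \<T> e] sum_nonneg l2_norm_nonneg)
  finally have "?n * ?n \<le> (4 * R * err) * ?n"
    by (simp only: power2_eq_square mult_ac)
  moreover have "0 \<le> 4 * R * err"
    using R by (intro mult_nonneg_nonneg sum_nonneg l2_norm_nonneg) auto
  \<comment> \<open>One factor \<open>?n\<close> is cancelled; when it is zero, nonnegativity of the
    bound suffices.\<close>
  ultimately show ?thesis
    using l2_norm_nonneg[of \<Omega> "wgrad \<Omega> ?e"] mult_right_le_imp_le[of ?n ?n "4 * R * err"]
    by (cases "?n = 0") (simp_all only: less_le, auto)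
qed

text \<open>Of the two summands in the constant, \<open>M\<close> comes from the concentration
  difference times the fine potential gradient, and \<open>M * (4 * R)\<close> from the coarse
  concentration times the potential error.\<close>

lemma concentration_error:
  assumes i: "i \<in> {1, 2}"
  shows "l2_norm \<Omega> (wgrad \<Omega> (\<lambda>x. p i x - ps i x)) \<le> M * (1 + 4 * R) * err"
proof -
  let ?e = "\<lambda>x. p i x - ps i x" and ?\<eta> = "\<lambda>x. \<phi> x - \<phi>s x"
  let ?n = "l2_norm \<Omega> (wgrad \<Omega> ?e)"
  have e: "?e \<in> Sh \<Omega> \<T>" by (rule Sh_diff[OF \<Omega> in_Sh(1,3)[OF i]])
  have \<eta>: "?\<eta> \<in> Sh \<Omega> \<T>" by (rule Sh_diff[OF \<Omega> in_Sh(4,5)])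
  have [measurable]: "p i \<in> borel_measurable (lebesgue_on \<Omega>)" "P i \<in> borel_measurable (lebesgue_on \<Omega>)"
    "wgrad \<Omega> \<phi> \<in> borel_measurable (lebesgue_on \<Omega>)" "wgrad \<Omega> \<phi>s \<in> borel_measurable (lebesgue_on \<Omega>)"
    "wgrad \<Omega> ?\<eta> \<in> borel_measurable (lebesgue_on \<Omega>)"
    using in_Sh(1,2)[OF i] in_Sh(4,5) \<eta> by (auto simp: Sh_def H1_def L2_def)
  \<comment> \<open>Without integrability the Bochner integral defaults to 0 and could not be split.
    The mesh \<open>S\<close> is free, since the drift terms involve both fine and coarse
    concentrations.\<close>
  have drift_L2: "(\<lambda>x. (q i * u x) *\<^sub>R g x) \<in> L2 \<Omega>"
    if u: "u \<in> Sh \<Omega> S" and S: "triangulation_of \<Omega> S" and g: "g \<in> L2 \<Omega>" for u S and g :: "'a \<Rightarrow> 'a"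
  proof -
    obtain B where B: "0 \<le> B" "AE x in lebesgue_on \<Omega>. norm (u x) \<le> B"
      using Sh_AE_bounded[OF bounded_subset[OF bounded_ball R(1)] S u] .
    have m: "u \<in> borel_measurable (lebesgue_on \<Omega>)" "g \<in> borel_measurable (lebesgue_on \<Omega>)"
      using g Sh_L2(1)[OF u] by (auto simp: L2_def)
    show ?thesis
    proof (rule L2_dominated(1)[OF _ g B(1)])
      show "AE x in lebesgue_on \<Omega>. norm ((q i * u x) *\<^sub>R g x) \<le> B * norm (g x)"
        using B(2) by eventually_elim (simp add: abs_mult abs_q mult_right_mono)
    qed (use m in measurable)
  qed
  \<comment> \<open>\<open>?a\<close> and \<open>?b\<close> are the drift terms of the fine and the
    two-grid equation; \<open>?b - ?a\<close> is split as \<open>?c - ?d\<close>.\<close>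
  let ?a = "\<lambda>x. (q i * p i x) *\<^sub>R wgrad \<Omega> \<phi> x" and ?b = "\<lambda>x. (q i * P i x) *\<^sub>R wgrad \<Omega> \<phi>s x"
  let ?c = "\<lambda>x. (q i * (P i x - p i x)) *\<^sub>R wgrad \<Omega> \<phi> x" and ?d = "\<lambda>x. (q i * P i x) *\<^sub>R wgrad \<Omega> ?\<eta> x"
  have a: "?a \<in> L2 \<Omega>" by (rule drift_L2[OF in_Sh(1)[OF i] \<T> Sh_L2(2)[OF in_Sh(4)]])
  have b: "?b \<in> L2 \<Omega>" by (rule drift_L2[OF in_Sh(2)[OF i] \<T>' Sh_L2(2)[OF in_Sh(5)]])
  have c: "?c \<in> L2 \<Omega>" "l2_norm \<Omega> ?c \<le> M * l2_norm \<Omega> (\<lambda>x. p i x - P i x)"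
  proof -
    have "AE x in lebesgue_on \<Omega>. norm (?c x) \<le> M * norm (p i x - P i x)"
      using grad_\<phi>
    proof eventually_elim
      case (elim x)
      from mult_left_mono[OF this abs_ge_zero[of "P i x - p i x"]] show ?case
        by (simp add: abs_mult abs_q abs_minus_commute mult.commute)
    qed
    then show "?c \<in> L2 \<Omega>" "l2_norm \<Omega> ?c \<le> M * l2_norm \<Omega> (\<lambda>x. p i x - P i x)"
      using L2_dominated[OF _ concentration_diff_L2[OF i] M, of ?c] by measurable
  qed
  have d: "?d \<in> L2 \<Omega>" "l2_norm \<Omega> ?d \<le> M * l2_norm \<Omega> (wgrad \<Omega> ?\<eta>)"
  proof -
    have "AE x in lebesgue_on \<Omega>. norm (?d x) \<le> M * norm (wgrad \<Omega> ?\<eta> x)"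
      using P_bound[OF i] by eventually_elim (simp add: abs_mult abs_q mult_right_mono)
    then show "?d \<in> L2 \<Omega>" "l2_norm \<Omega> ?d \<le> M * l2_norm \<Omega> (wgrad \<Omega> ?\<eta>)"
      using L2_dominated[OF _ Sh_L2(2)[OF \<eta>] M, of ?d] by measurable
  qed
  have "?n\<^sup>2 = l2_inner \<Omega> (wgrad \<Omega> (p i)) (wgrad \<Omega> ?e) - l2_inner \<Omega> (wgrad \<Omega> (ps i)) (wgrad \<Omega> ?e)"
    unfolding l2_norm_power2
    by (rule l2_inner_wgrad_diff[OF \<Omega> Sh_L2(3)[OF in_Sh(1)[OF i]] Sh_L2(3)[OF in_Sh(3)[OF i]] Sh_L2(2)[OF e]])
  also have "\<dots> = l2_inner \<Omega> ?b (wgrad \<Omega> ?e) - l2_inner \<Omega> ?a (wgrad \<Omega> ?e)"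
  proof -
    have "l2_inner \<Omega> (wgrad \<Omega> (p i)) (wgrad \<Omega> ?e) + l2_inner \<Omega> ?a (wgrad \<Omega> ?e) = l2_inner \<Omega> (F i) ?e"
      "l2_inner \<Omega> (wgrad \<Omega> (ps i)) (wgrad \<Omega> ?e) + l2_inner \<Omega> ?b (wgrad \<Omega> ?e) = l2_inner \<Omega> (F i) ?e"
      using fine semi e i
      unfolding fe_solution_def pnp_system_def semi_decoupled_two_grid_solution_def by blast+
    then show ?thesis by linarith
  qed
  also have "\<dots> = l2_inner \<Omega> (\<lambda>x. ?b x - ?a x) (wgrad \<Omega> ?e)"
    by (rule l2_inner_diff_left[OF b a Sh_L2(2)[OF e], symmetric])
  \<comment> \<open>The splitting holds only almost everywhere, because \<open>wgrad\<close>
    respects differences only up to null sets.\<close>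
  also have "\<dots> = l2_inner \<Omega> (\<lambda>x. ?c x - ?d x) (wgrad \<Omega> ?e)"
  proof (rule l2_inner_cong_AE[OF L2_diff[OF b a] L2_diff[OF c(1) d(1)] Sh_L2(2)[OF e]])
    show "AE x in lebesgue_on \<Omega>. ?b x - ?a x = ?c x - ?d x"
      using AE_wgrad_diff[OF \<Omega> Sh_L2(3)[OF in_Sh(4)] Sh_L2(3)[OF in_Sh(5)]]
    proof eventually_elim
      case (elim x)
      show ?case unfolding elim[symmetric] by (simp add: algebra_simps)
    qed
  qed
  also have "\<dots> = l2_inner \<Omega> ?c (wgrad \<Omega> ?e) - l2_inner \<Omega> ?d (wgrad \<Omega> ?e)"
    by (rule l2_inner_diff_left[OF c(1) d(1) Sh_L2(2)[OF e]])
  also have "\<dots> \<le> l2_norm \<Omega> ?c * ?n + l2_norm \<Omega> ?d * ?n"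
    using l2_Cauchy_Schwarz[OF c(1) Sh_L2(2)[OF e]] l2_Cauchy_Schwarz[OF d(1) Sh_L2(2)[OF e]] by linarith
  finally have "?n * ?n \<le> (l2_norm \<Omega> ?c + l2_norm \<Omega> ?d) * ?n"
    by (simp add: power2_eq_square distrib_right)
  then have "?n \<le> l2_norm \<Omega> ?c + l2_norm \<Omega> ?d"
    using l2_norm_nonneg[of \<Omega> "wgrad \<Omega> ?e"] l2_norm_nonneg[of \<Omega> ?c] l2_norm_nonneg[of \<Omega> ?d]
    by (cases "?n = 0") auto
  also have "\<dots> \<le> M * err + M * (4 * R * err)"
  proof (rule add_mono)
    have "l2_norm \<Omega> (\<lambda>x. p i x - P i x) \<le> err"
      using i by (intro member_le_sum l2_norm_nonneg) auto
    then show "l2_norm \<Omega> ?c \<le> M * err" using c(2) M by (meson mult_left_mono order_trans)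
    show "l2_norm \<Omega> ?d \<le> M * (4 * R * err)"
      using d(2) M potential_error by (meson mult_left_mono order_trans)
  qed
  finally show ?thesis by (simp add: algebra_simps)
qed

end

theorem theorem3p2:
  fixes \<Omega> :: "'a::euclidean_space set"
    and I :: "real set"
    and \<Gamma> :: "real \<Rightarrow> 'a set set"
    and F :: "nat \<Rightarrow> 'a \<Rightarrow> real"
    and M :: real
  assumes "DIM('a) = 2 \<or> DIM('a) = 3"
    and "bounded_lipschitz_domain \<Omega>"
    and "\<forall>i\<in>{1,2,3}. F i \<in> L2 \<Omega>"
    and "quasi_uniform_family \<Omega> I \<Gamma>"
    and "uniquely_solvable \<Omega> (weak_solution \<Omega> F)"
    and "\<forall>h\<in>I. uniquely_solvable \<Omega> (fe_solution \<Omega> (\<Gamma> h) F)"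
  shows "\<exists>C>0. \<forall>h\<in>I. \<forall>H\<in>I. \<forall>ph \<phi>h pH \<phi>H ps \<phi>s.
           fe_solution \<Omega> (\<Gamma> h) F ph \<phi>h \<longrightarrow>
           fe_solution \<Omega> (\<Gamma> H) F pH \<phi>H \<longrightarrow>
           semi_decoupled_two_grid_solution \<Omega> (\<Gamma> h) F pH ps \<phi>s \<longrightarrow>
           \<phi>h \<in> W1inf \<Omega> \<longrightarrow> w1inf_norm \<Omega> \<phi>h \<le> ereal M \<longrightarrow>
           (\<forall>i\<in>{1,2}. pH i \<in> Linf \<Omega> \<and> linf_norm \<Omega> (pH i) \<le> ereal M) \<longrightarrow>
           (\<forall>i\<in>{1,2}.
              l2_norm \<Omega> (wgrad \<Omega> (\<lambda>x. ph i x - ps i x))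
              \<le> C * (\<Sum>j\<in>{1,2}. l2_norm \<Omega> (\<lambda>x. ph j x - pH j x)))"
proof -
  have \<Omega>: "open \<Omega>" "bounded \<Omega>"
    using assms(2) by (auto simp: bounded_lipschitz_domain_def)
  obtain R where R: "R > 0" "\<Omega> \<subseteq> ball 0 R"
    using bounded_subset_ballD[OF \<Omega>(2)] by blast
  \<comment> \<open>The given \<open>M\<close> need not be positive; the maximum keeps the constant
    positive while still bounding the norms.\<close>
  let ?M = "max M 1"
  have AE_M: "AE x in lebesgue_on \<Omega>. norm (u x) \<le> ?M"
    if "linf_norm \<Omega> u \<le> ereal M" for u :: "'a \<Rightarrow> 'b::euclidean_space"
    using Linf_AE_bound[OF that] by eventually_elim simp
  show ?thesis
  \<comment> \<open>The witness is fixed before \<open>h\<close> and \<open>H\<close> and contains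
    only the bound and the radius of a ball around the domain.\<close>
  proof (intro exI[of _ "?M * (1 + 4 * R)"] conjI ballI allI impI)
    show "0 < ?M * (1 + 4 * R)" using R by (intro mult_pos_pos) auto
  next
    fix h H ph \<phi>h pH \<phi>H ps \<phi>s i
    assume hH: "h \<in> I" "H \<in> I" and sol: "fe_solution \<Omega> (\<Gamma> h) F ph \<phi>h" "fe_solution \<Omega> (\<Gamma> H) F pH \<phi>H"
      "semi_decoupled_two_grid_solution \<Omega> (\<Gamma> h) F pH ps \<phi>s"
      and \<phi>h: "w1inf_norm \<Omega> \<phi>h \<le> ereal M"
      and pH: "\<forall>i\<in>{1,2}. pH i \<in> Linf \<Omega> \<and> linf_norm \<Omega> (pH i) \<le> ereal M" and i: "i \<in> {1, 2::nat}"
    interpret two_grid \<Omega> "\<Gamma> h" "\<Gamma> H" F ph pH ps \<phi>h \<phi>H \<phi>s R ?M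
    proof
      show "triangulation_of \<Omega> (\<Gamma> h)" "triangulation_of \<Omega> (\<Gamma> H)"
        using assms(4) hH by (auto simp: quasi_uniform_family_def)
      show "AE x in lebesgue_on \<Omega>. norm (wgrad \<Omega> \<phi>h x) \<le> ?M"
        using \<phi>h by (intro AE_M) (simp add: w1inf_norm_def)
      show "AE x in lebesgue_on \<Omega>. norm (pH i x) \<le> ?M" if "i \<in> {1, 2}" for i
        using pH that by (intro AE_M) blast
    qed (use \<Omega> R sol in auto)
    show "l2_norm \<Omega> (wgrad \<Omega> (\<lambda>x. ph i x - ps i x))
        \<le> ?M * (1 + 4 * R) * (\<Sum>j\<in>{1,2}. l2_norm \<Omega> (\<lambda>x. ph j x - pH j x))"
      by (rule concentration_error[OF i])
  qed
qed

end
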